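(* Let $G$ be a finite group. Let $q$ and $r$ be distinct odd prime numbers. Then $G \cong \mathrm{PSL}(2,5)$ or $G \cong \mathbb{Z}_{2qr}$ if and only if $\operatorname{Exp}_{\rho}(G) = \operatorname{Exp}_{\rho}(\mathbb{Z}_{2qr})$.
   Context: For a finite group $G$, $o(g)$ denotes the order of $g\in G$ and $\rho(G)=\prod_{g\in G} o(g)$ is the product of the element orders. If $n=p_1^{\alpha_1}\cdots p_k^{\alpha_k}$ is the prime factorization of $n$, with $p_1,\dots,p_k$ distinct primes, then $\operatorname{Exp}(n)=\{\alpha_1,\dots,\alpha_k\}$ is the set of exponents in this factorization. Set $\operatorname{Exp}_{\rho}(G)=\operatorname{Exp}(\rho(G))$. $\mathbb{Z}_n$ denotes the cyclic group of order $n$, and $\mathrm{PSL}(2,5)$ is the projective special linear group of degree 2 over the field with 5 elements.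
   Formalization: The alternative G ≅ PSL(2,5) carries the extra condition {q,r} = {3,5}; without it the claim fails, e.g. for q=3, r=7, where PSL(2,5) has exponent set {15,20,24} but Z_42 has {21,28,36}. *)

theory Defs
  imports
    "HOL-Analysis.Determinants"
    "HOL-Algebra.Elementary_Groups"
    "HOL-Algebra.Multiplicative_Group"
    "HOL-Library.Numeral_Type"
    "HOL-Computational_Algebra.Primes"
begin

definition rho :: "('a, 'b) monoid_scheme \<Rightarrow> nat" where
  "rho G = (\<Prod>g\<in>carrier G. group.ord G g)"

text \<open>The exponents form a set, so repeated exponents are not counted, and primes
  not dividing \<open>n\<close> contribute nothing (in particular no exponent 0).\<close>

definition Exp :: "nat \<Rightarrow> nat set" where
  "Exp n = (\<lambda>p. multiplicity p n) ` prime_factors n"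

definition Exp_rho :: "('a, 'b) monoid_scheme \<Rightarrow> nat set" where
  "Exp_rho G = Exp (rho G)"

definition centre :: "('a, 'b) monoid_scheme \<Rightarrow> 'a set" where
  "centre G = {z \<in> carrier G. \<forall>g\<in>carrier G. z \<otimes>\<^bsub>G\<^esub> g = g \<otimes>\<^bsub>G\<^esub> z}"

definition SL :: "('a::comm_ring_1 ^ 'n ^ 'n) monoid" where
  "SL = \<lparr>carrier = {A. det A = 1}, mult = (**), one = mat 1\<rparr>"

definition PSL :: "('a::comm_ring_1 ^ 'n ^ 'n) set monoid" where
  "PSL = SL Mod centre SL"

text \<open>The type \<open>5\<close> from \<open>Numeral_Type\<close> is the ring of integers modulo 5; it is only an
  instance of \<open>comm_ring_1\<close>, but it is a field by the lemma \<open>field_5\<close> below. The type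
  \<open>2\<close> serves as a two-element index set.\<close>

definition PSL_2_5 :: "(5 ^ 2 ^ 2) set monoid" where
  "PSL_2_5 = PSL"

lemma field_5: "CARD(5) = 5" "(x::5) \<noteq> 0 \<Longrightarrow> \<exists>y. x * y = 1"
proof -
  show "CARD(5) = 5" by simp
  have *: "(2::5) * 3 = 1" "(3::5) * 2 = 1" "(4::5) * 4 = 1" "(1::5) * 1 = 1"
    by simp_all
  have "x = 0 \<or> x = 1 \<or> x = 2 \<or> x = 3 \<or> x = 4"
  proof (induct x rule: bit1_induct)
    case (of_int z)
    then have "z = 0 \<or> z = 1 \<or> z = 2 \<or> z = 3 \<or> z = 4"
      by simp presburger
    then show ?case by (elim disjE) simp_all
  qed
  then show "x \<noteq> 0 \<Longrightarrow> \<exists>y. x * y = 1"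
    using * by blast
qed

lemma group_SL: "group (SL :: ('a::comm_ring_1 ^ 2 ^ 2) monoid)"
proof (rule groupI)
  fix A :: "'a ^ 2 ^ 2"
  assume A: "A \<in> carrier SL"
  define B :: "'a ^ 2 ^ 2" where
    "B = (\<chi> i j. if i = 1 then (if j = 1 then A$2$2 else - A$1$2)
                          else (if j = 1 then - A$2$1 else A$1$1))"
  have "B ** A = mat (det A)" "det B = det A"
    by (simp_all add: B_def det_2 vec_eq_iff matrix_matrix_mult_def
        sum_2 forall_2 mat_def mult.commute)
  with A have "B ** A = mat 1" "det B = 1"
    by (simp_all add: SL_def)
  then show "\<exists>B\<in>carrier SL. B \<otimes>\<^bsub>SL\<^esub> A = \<one>\<^bsub>SL\<^esub>"
    by (auto simp: SL_def)
qed (auto simp: SL_def det_mul matrix_mul_assoc)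

lemma centre_iff:
  "z \<in> centre G \<longleftrightarrow> z \<in> carrier G \<and> (\<forall>g\<in>carrier G. z \<otimes>\<^bsub>G\<^esub> g = g \<otimes>\<^bsub>G\<^esub> z)"
  unfolding centre_def by (rule mem_Collect_eq)

lemma normal_centre:
  fixes G (structure)
  assumes "group G"
  shows "centre G \<lhd> G"
proof -
  interpret group G by fact
  have carr: "z \<in> carrier G" if "z \<in> centre G" for z
    by (rule conjunct1[OF that[unfolded centre_iff]])
  have comm: "z \<otimes> g = g \<otimes> z" if "z \<in> centre G" "g \<in> carrier G" for z g
    by (rule bspec[OF conjunct2[OF that(1)[unfolded centre_iff]] that(2)])
  have centreI: "z \<in> centre G"
    if "z \<in> carrier G" "\<And>g. g \<in> carrier G \<Longrightarrow> z \<otimes> g = g \<otimes> z" for z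
    unfolding centre_iff by (intro conjI ballI that)
  have "subgroup (centre G) G"
  proof (rule subgroupI)
    fix a assume a: "a \<in> centre G"
    note carr[OF a, simp]
    show "inv a \<in> centre G"
    proof (rule centreI)
      fix g assume g: "g \<in> carrier G"
      have "inv a \<otimes> (a \<otimes> g) \<otimes> inv a = inv a \<otimes> (g \<otimes> a) \<otimes> inv a"
        by (simp only: comm[OF a g])
      moreover have "inv a \<otimes> (a \<otimes> g) = g" using g by (simp flip: m_assoc)
      moreover have "inv a \<otimes> (g \<otimes> a) \<otimes> inv a = inv a \<otimes> g" using g by (simp add: m_assoc)
      ultimately show "inv a \<otimes> g = g \<otimes> inv a" by argo
    qed simp
  next
    fix a b assume a: "a \<in> centre G" and b: "b \<in> centre G"
    note carr[OF a, simp] carr[OF b, simp]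
    show "a \<otimes> b \<in> centre G"
    proof (rule centreI)
      fix g assume g [simp]: "g \<in> carrier G"
      have "a \<otimes> b \<otimes> g = a \<otimes> (b \<otimes> g)" by (simp add: m_assoc)
      also have "b \<otimes> g = g \<otimes> b" by (rule comm[OF b g])
      also have "a \<otimes> (g \<otimes> b) = a \<otimes> g \<otimes> b" by (simp add: m_assoc)
      also have "a \<otimes> g = g \<otimes> a" by (rule comm[OF a g])
      also have "g \<otimes> a \<otimes> b = g \<otimes> (a \<otimes> b)" by (simp add: m_assoc)
      finally show "a \<otimes> b \<otimes> g = g \<otimes> (a \<otimes> b)" .
    qed simp
  next
    show "centre G \<subseteq> carrier G" by (rule subsetI) (rule carr)
    have "\<one> \<in> centre G" by (rule centreI) simp_all
    then show "centre G \<noteq> {}" by blast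
  qed
  moreover have "centre G #> x = x <# centre G" if x: "x \<in> carrier G" for x
    unfolding r_coset_def l_coset_def
    by (rule SUP_cong[OF refl]) (simp only: comm[OF _ x])
  ultimately show ?thesis
    by (intro normalI ballI)
qed

lemma group_PSL_2_5: "group PSL_2_5"
  unfolding PSL_2_5_def PSL_def
  by (intro normal.factorgroup_is_group normal_centre group_SL)

end

(*
Write v p for the exponent of p in rho G. For odd p it is even, as inversion has no fixed point
among the elements of order divisible by p; so the odd value q r can only be v 2. A theorem of
Frobenius type says that a conjugation invariant count depending only on the 2-part of an element is
divisible by the odd part of |G|. Applied to v 2 it gives |G| = 2^a q r, after which the numbers of
elements of order divisible by 2, q and r are known, and counting leaves a = 1 or a = 2.

If a = 1, some element has order divisible by 2, q and r, so G is cyclic. If a = 2, the involutions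
are all conjugate, there are q r of them, and their centralizers have order 4 and pairwise meet
trivially when distinct, so the involutions split into triples and {q, r} contains 3; counting the elements of order
divisible by 3 and by the other prime shows that this prime is 5. The action on the 5 centralizers
is faithful, and the 45 elements of odd order act as even permutations, which forces G to be A_5.
The exponents of PSL(2,5) are found by counting matrices by trace, so the same argument identifies
PSL(2,5) with A_5.
*)

theory Submission
  imports
    Defs
    "HOL-Algebra.Sylow"
    "HOL-Algebra.Sym_Groups"
    "HOL-Number_Theory.Cong"
    "HOL-Number_Theory.Totient"
begin

section \<open>Frobenius divisibility\<close>

text \<open>The lever is that a divisibility and a size bound meet. The odd part of the order
  divides the exponent of 2, which is only \<open>q * r\<close>; it is also divisible by two
  distinct odd primes, because the two even exponents differ, and so it equals \<open>q * r\<close>.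
  The number of elements of even order is a positive multiple of the same odd part and is at most
  the exponent of 2. So every such element contributes exactly 1, and no element order is divisible
  by 4. This turns the exponents into plain element counts and makes every subgroup of order 4 a
  Klein four-group.

  The exponent of a prime p is a weighted count, so the divisibility is proved for arbitrary class
  functions of the p-part. Grouping elements by their p-part y leaves the task of counting the
  commuting factors in the centralizer of y; this is why the Frobenius statement is formulated for
  all subgroups, with a divisor \<open>k\<close> that can shrink during the induction.\<close>

definition centralizer :: "('a, 'b) monoid_scheme \<Rightarrow> 'a set \<Rightarrow> 'a \<Rightarrow> 'a set" where
  "centralizer G H y = {h \<in> H. h \<otimes>\<^bsub>G\<^esub> y = y \<otimes>\<^bsub>G\<^esub> h}"

text \<open>Like \<open>centralizer\<close>, taken relative to a subset \<open>H\<close>, so that an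
  induction over subgroups stays inside one ambient group and keeps its powers and inverses.\<close>

definition conj_class :: "('a, 'b) monoid_scheme \<Rightarrow> 'a set \<Rightarrow> 'a \<Rightarrow> 'a set" where
  "conj_class G H y = (\<lambda>h. h \<otimes>\<^bsub>G\<^esub> y \<otimes>\<^bsub>G\<^esub> inv\<^bsub>G\<^esub> h) ` H"

section \<open>Conjugation, classes and centralizers relative to a subgroup\<close>

context group
begin

lemma conj_eq_iff:
  assumes "h \<in> carrier G" "y \<in> carrier G" "z \<in> carrier G"
  shows "h \<otimes> y \<otimes> inv h = z \<longleftrightarrow> h \<otimes> y = z \<otimes> h"
  using assms by (metis inv_solve_right m_closed)

lemma conj_conj:
  assumes "h \<in> carrier G" "k \<in> carrier G" "y \<in> carrier G"
  shows "h \<otimes> (k \<otimes> y \<otimes> inv k) \<otimes> inv h = (h \<otimes> k) \<otimes> y \<otimes> inv (h \<otimes> k)"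
  using assms by (simp add: m_assoc inv_mult_group)

lemma inv_conj_conj:
  assumes "h \<in> carrier G" "y \<in> carrier G"
  shows "inv h \<otimes> (h \<otimes> y \<otimes> inv h) \<otimes> h = y"
  using assms by (simp add: m_assoc) (simp flip: m_assoc)

lemma conj_inject:
  assumes "h \<in> carrier G" "y \<in> carrier G" "z \<in> carrier G"
  shows "h \<otimes> y \<otimes> inv h = h \<otimes> z \<otimes> inv h \<longleftrightarrow> y = z"
  using inv_conj_conj assms by metis

lemma conj_pow:
  assumes "h \<in> carrier G" "y \<in> carrier G"
  shows "(h \<otimes> y \<otimes> inv h) [^] (n::nat) = h \<otimes> y [^] n \<otimes> inv h"
proof (induction n)
  case (Suc n)
  have "(h \<otimes> y \<otimes> inv h) [^] Suc n = h \<otimes> y [^] n \<otimes> (inv h \<otimes> (h \<otimes> y \<otimes> inv h) \<otimes> h) \<otimes> inv h"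
    using Suc assms by (simp add: m_assoc)
  then show ?case using assms by (simp add: inv_conj_conj) (simp add: m_assoc)
qed (use assms in simp)

lemma subgroup_centralizer:
  assumes "subgroup H G" "y \<in> carrier G"
  shows "subgroup (centralizer G H y) G"
proof (rule subgroupI)
  interpret H: subgroup H G by fact
  show "centralizer G H y \<subseteq> carrier G" by (auto simp: centralizer_def)
  show "centralizer G H y \<noteq> {}" using assms by (auto simp: centralizer_def intro!: exI[of _ \<one>])
  fix a assume "a \<in> centralizer G H y"
  then have a: "a \<in> H" "a \<otimes> y = y \<otimes> a" by (auto simp: centralizer_def)
  have ac: "a \<in> carrier G" using a by auto
  have "inv a \<otimes> (a \<otimes> y) \<otimes> inv a = inv a \<otimes> (y \<otimes> a) \<otimes> inv a" using a by simp
  then have "y \<otimes> inv a = inv a \<otimes> y"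
    using ac assms(2) by (metis inv_closed l_inv l_one m_assoc m_closed r_inv r_one)
  then show "inv a \<in> centralizer G H y" using a by (auto simp: centralizer_def)
  fix b assume "b \<in> centralizer G H y"
  then have b: "b \<in> H" "b \<otimes> y = y \<otimes> b" by (auto simp: centralizer_def)
  have bc: "b \<in> carrier G" using b by auto
  have "a \<otimes> b \<otimes> y = y \<otimes> (a \<otimes> b)"
    using a b ac bc assms(2) by (metis m_assoc)
  then show "a \<otimes> b \<in> centralizer G H y" using a b by (auto simp: centralizer_def)
qed

text \<open>Orbit-stabilizer: the elements of \<open>H\<close> conjugating \<open>y\<close> to
  \<open>z = k \<otimes> y \<otimes> inv k\<close> form the left coset of the centralizer by
  \<open>k\<close>, so all fibres over the class have the same size.\<close>

lemma card_conj_class_centralizer: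
  assumes "subgroup H G" "y \<in> carrier G" "finite H"
  shows "card (conj_class G H y) * card (centralizer G H y) = card H"
proof -
  interpret H: subgroup H G by fact
  let ?f = "\<lambda>h. h \<otimes> y \<otimes> inv h"
  have "card H = (\<Sum>z\<in>conj_class G H y. card {h \<in> H. ?f h = z})"
    using sum.group[OF assms(3), of "conj_class G H y" ?f "\<lambda>_. 1::nat"] assms(3)
    by (simp add: conj_class_def)
  also have "\<dots> = (\<Sum>z\<in>conj_class G H y. card (centralizer G H y))"
  proof (rule sum.cong[OF refl])
    fix z assume "z \<in> conj_class G H y"
    then obtain k where k: "k \<in> H" "z = ?f k" by (auto simp: conj_class_def)
    have kc: "k \<in> carrier G" using k by auto
    have eq: "?f (k \<otimes> c) = z \<longleftrightarrow> c \<otimes> y = y \<otimes> c" if "c \<in> carrier G" for c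
    proof -
      have "?f (k \<otimes> c) = k \<otimes> ?f c \<otimes> inv k"
        using kc that assms(2) by (simp add: conj_conj)
      then have "?f (k \<otimes> c) = z \<longleftrightarrow> ?f c = y"
        using kc that assms(2) k(2) by (simp add: conj_inject)
      then show ?thesis using conj_eq_iff that assms(2) by simp
    qed
    have "bij_betw (\<lambda>c. k \<otimes> c) (centralizer G H y) {h \<in> H. ?f h = z}"
    proof (rule bij_betwI')
      fix a b assume "a \<in> centralizer G H y" "b \<in> centralizer G H y"
      then show "(k \<otimes> a = k \<otimes> b) = (a = b)" using kc by (auto simp: centralizer_def)
    next
      fix a assume "a \<in> centralizer G H y"
      then show "k \<otimes> a \<in> {h \<in> H. ?f h = z}" using eq[of a] k by (auto simp: centralizer_def)
    next
      fix h assume h: "h \<in> {h \<in> H. ?f h = z}"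
      then have "h = k \<otimes> (inv k \<otimes> h)" using kc by (simp flip: m_assoc)
      moreover have "inv k \<otimes> h \<in> H" using h k by auto
      ultimately show "\<exists>c\<in>centralizer G H y. h = k \<otimes> c"
        using eq[of "inv k \<otimes> h"] h by (intro bexI[of _ "inv k \<otimes> h"]) (auto simp: centralizer_def)
    qed
    then show "card {h \<in> H. ?f h = z} = card (centralizer G H y)"
      by (rule bij_betw_same_card[symmetric])
  qed
  finally show ?thesis by simp
qed

text \<open>\<open>X\<close> is a disjoint union of \<open>H\<close>-classes and \<open>f\<close> is
  constant on each, so the sum splits into terms of the form class size times value.\<close>

lemma dvd_sum_class_function:
  fixes f :: "'a \<Rightarrow> nat"
  assumes "subgroup H G" "finite X" "X \<subseteq> carrier G"
    and closed: "\<And>h x. h \<in> H \<Longrightarrow> x \<in> X \<Longrightarrow> h \<otimes> x \<otimes> inv h \<in> X"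
    and class_fun: "\<And>h x. h \<in> H \<Longrightarrow> x \<in> X \<Longrightarrow> f (h \<otimes> x \<otimes> inv h) = f x"
    and dvd: "\<And>x. x \<in> X \<Longrightarrow> k dvd card (conj_class G H x) * f x"
  shows "k dvd sum f X"
proof -
  interpret H: subgroup H G by fact
  have self: "x \<in> conj_class G H x" if "x \<in> carrier G" for x
    using that by (auto simp: conj_class_def image_iff intro!: bexI[of _ \<one>])
  have sub: "conj_class G H y \<subseteq> conj_class G H x" if "y \<in> conj_class G H x" "x \<in> carrier G" for x y
    using that by (auto simp: conj_class_def conj_conj)
  have sym: "x \<in> conj_class G H y" if "y \<in> conj_class G H x" "x \<in> carrier G" for x y
  proof -
    from that obtain h where h: "h \<in> H" "y = h \<otimes> x \<otimes> inv h" by (auto simp: conj_class_def)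
    then have "x = inv h \<otimes> y \<otimes> inv (inv h)"
      using that(2) by (simp add: inv_conj_conj)
    then show ?thesis using h by (auto simp: conj_class_def intro!: image_eqI[of _ _ "inv h"])
  qed
  have inX: "y \<in> X" if "y \<in> conj_class G H x" "x \<in> X" for x y
    using that closed by (auto simp: conj_class_def)
  let ?C = "conj_class G H ` X"
  have X: "X = \<Union> ?C" using self inX assms(3) by blast
  have eqcl: "conj_class G H y = conj_class G H x" if "y \<in> conj_class G H x" "x \<in> X" for x y
    using sub[of y x] sub[of x y] sym[of y x] inX[of y x] that assms(3) by blast
  have fin: "finite A" if "A \<in> ?C" for A
    using that inX by (auto intro: finite_subset[OF _ assms(2)])
  have disj: "A \<inter> B = {}" if A: "A \<in> ?C" and B: "B \<in> ?C" and "A \<noteq> B" for A B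
  proof (rule ccontr)
    assume "A \<inter> B \<noteq> {}"
    then obtain z where z: "z \<in> A" "z \<in> B" by blast
    obtain x y where "x \<in> X" "A = conj_class G H x" "y \<in> X" "B = conj_class G H y"
      using A B by blast
    then show False using eqcl[of z x] eqcl[of z y] z \<open>A \<noteq> B\<close> by simp
  qed
  have "sum f (\<Union> ?C) = (\<Sum>A\<in>?C. sum f A)"
    using fin disj by (subst sum.Union_disjoint) auto
  moreover have "k dvd sum f A" if "A \<in> ?C" for A
  proof -
    from that obtain x where x: "x \<in> X" "A = conj_class G H x" by auto
    have "sum f A = (\<Sum>y\<in>A. f x)"
      using x class_fun by (intro sum.cong) (auto simp: conj_class_def)
    then show ?thesis using dvd[OF x(1)] x by simp
  qed
  ultimately show ?thesis using X by (metis dvd_sum)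
qed


section \<open>Powers, Cauchy's theorem and the splitting of an element into commuting parts\<close>

lemma pow_cong:
  assumes "x \<in> carrier G" "x [^] (k::nat) = \<one>" "[a = b] (mod k)"
  shows "x [^] a = x [^] b"
proof -
  have "[a = b] (mod ord x)"
    using assms by (metis cong_dvd_modulus_nat pow_eq_id)
  then have "x [^] (a mod ord x) = x [^] (b mod ord x)" by (simp add: cong_def)
  moreover have "x [^] (c mod ord x) = x [^] c" for c
  proof -
    have "x [^] c = x [^] (c mod ord x) \<otimes> (x [^] ord x) [^] (c div ord x)"
      using assms(1) by (simp only: nat_pow_pow nat_pow_mult mod_mult_div_eq)
    then show ?thesis using assms(1) by simp
  qed
  ultimately show ?thesis by metis
qed

lemma inv_commute:
  assumes "y \<in> carrier G" "h \<in> carrier G" "y \<otimes> h = h \<otimes> y"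
  shows "inv y \<otimes> h = h \<otimes> inv y"
proof -
  have "inv y \<otimes> (y \<otimes> h) \<otimes> inv y = h \<otimes> inv y"
    using assms(1,2) by (simp flip: m_assoc)
  moreover have "inv y \<otimes> (h \<otimes> y) \<otimes> inv y = inv y \<otimes> h"
    using assms(1,2) by (simp add: m_assoc)
  ultimately show ?thesis using assms(3) by simp
qed

lemma subgroup_pow_closed:
  assumes "subgroup H G" "x \<in> H"
  shows "x [^] (n::nat) \<in> H"
  using assms by (induction n) (auto simp: subgroup.one_closed subgroup.m_closed)

lemma subgroup_pow_card_eq_1:
  assumes "subgroup H G" "x \<in> H"
  shows "x [^] card H = \<one>"
proof -
  interpret H: group "G\<lparr>carrier := H\<rparr>" using assms(1) by (rule subgroup_imp_group)
  show ?thesis using H.pow_order_eq_1[of x] assms(2)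
    by (simp add: order_def nat_pow_consistent[of x _ H])
qed

text \<open>A weak form of Cauchy's theorem: any nontrivial element of a Sylow
  \<open>l\<close>-subgroup will do.\<close>

lemma exists_prime_power_order_element:
  assumes "subgroup H G" "finite H" "prime l" "l dvd card H"
  shows "\<exists>x\<in>H. \<exists>a. x \<noteq> \<one> \<and> x [^] (l ^ a :: nat) = \<one>"
proof -
  interpret H: group "G\<lparr>carrier := H\<rparr>" using assms(1) by (rule subgroup_imp_group)
  have H0: "card H \<noteq> 0"
    using assms(1,2) subgroup.one_closed by (metis card_0_eq empty_iff)
  define a where "a = multiplicity l (card H)"
  have a: "a > 0" using assms(3,4) H0 unfolding a_def
    by (simp add: prime_multiplicity_gt_zero_iff)
  obtain m where "card H = l ^ a * m"
    unfolding a_def using multiplicity_dvd by (metis dvdE)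
  then obtain K where K: "subgroup K (G\<lparr>carrier := H\<rparr>)" "card K = l ^ a"
    using sylow_thm[OF assms(3) H.is_group, of a m] assms(2) by (auto simp: order_def)
  have KG: "subgroup K G" "K \<subseteq> H"
    using K(1) assms(1) incl_subgroup subgroup.subset[OF K(1)] by auto
  have "card K > 1" using K(2) one_less_power[OF prime_gt_1_nat[OF assms(3)] a] by simp
  then have "\<not> K \<subseteq> {\<one>}" using card_mono[of "{\<one>}" K] by auto
  then obtain x where "x \<in> K" "x \<noteq> \<one>" by auto
  then show ?thesis using subgroup_pow_card_eq_1[OF KG(1)] K(2) KG(2) by auto
qed

text \<open>A prime \<open>l\<close> dividing both \<open>k\<close> and \<open>card H\<close> would
  yield a nontrivial element whose order divides a power of \<open>l\<close> and also
  \<open>u\<close>, which is prime to \<open>l\<close>.\<close>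

lemma coprime_card_subgroup:
  assumes "subgroup H G" "finite H" "\<And>x. x \<in> H \<Longrightarrow> x [^] (u::nat) = \<one>" "coprime k u"
  shows "coprime k (card H)"
proof (rule ccontr)
  interpret H: subgroup H G by fact
  assume "\<not> coprime k (card H)"
  then obtain l where l: "prime l" "l dvd k" "l dvd card H"
    using prime_factor_nat[of "gcd k (card H)"] by (auto simp: coprime_iff_gcd_eq_1)
  then obtain x a where x: "x \<in> H" "x \<noteq> \<one>" "x [^] (l ^ a :: nat) = \<one>"
    using exists_prime_power_order_element assms(1,2) by metis
  have "coprime l u" using l(2) assms(4) by (meson coprime_divisors dvd_refl)
  then have "coprime (l ^ a) u" by simp
  moreover have "ord x dvd l ^ a" "ord x dvd u"
    using x assms(3) pow_eq_id by (auto simp: H.mem_carrier)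
  ultimately have "ord x = 1" by (metis coprime_common_divisor_nat)
  then show False using x ord_eq_1 H.mem_carrier by auto
qed

lemma card_centralizer_pow_conj_le:
  assumes "subgroup H G" "finite H" "h \<in> H" "y \<in> carrier G"
  shows "card {x \<in> centralizer G H y. x [^] (v::nat) = \<one>}
    \<le> card {x \<in> centralizer G H (h \<otimes> y \<otimes> inv h). x [^] v = \<one>}"
proof (rule card_inj_on_le)
  interpret H: subgroup H G by fact
  have hc: "h \<in> carrier G" using assms by auto
  show "inj_on (\<lambda>x. h \<otimes> x \<otimes> inv h) {x \<in> centralizer G H y. x [^] v = \<one>}"
    using hc by (auto simp: inj_on_def centralizer_def conj_inject)
  show "finite {x \<in> centralizer G H (h \<otimes> y \<otimes> inv h). x [^] v = \<one>}"
    using assms(2) by (simp add: centralizer_def)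
  have "h \<otimes> x \<otimes> inv h \<otimes> (h \<otimes> y \<otimes> inv h) = h \<otimes> (x \<otimes> y) \<otimes> inv h"
    if "x \<in> carrier G" "y \<in> carrier G" for x y
  proof -
    have "h \<otimes> x \<otimes> inv h \<otimes> (h \<otimes> y \<otimes> inv h) = h \<otimes> x \<otimes> (inv h \<otimes> (h \<otimes> y \<otimes> inv h) \<otimes> h) \<otimes> inv h"
      using hc that by (simp add: m_assoc)
    then show ?thesis using hc that by (simp add: inv_conj_conj) (simp add: m_assoc)
  qed
  then show "(\<lambda>x. h \<otimes> x \<otimes> inv h) ` {x \<in> centralizer G H y. x [^] v = \<one>}
    \<subseteq> {x \<in> centralizer G H (h \<otimes> y \<otimes> inv h). x [^] v = \<one>}"
    using hc assms(3,4) by (auto simp: centralizer_def conj_pow)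
qed

lemma card_centralizer_pow_conj:
  assumes "subgroup H G" "finite H" "h \<in> H" "y \<in> carrier G"
  shows "card {x \<in> centralizer G H (h \<otimes> y \<otimes> inv h). x [^] (v::nat) = \<one>}
    = card {x \<in> centralizer G H y. x [^] v = \<one>}"
proof (rule antisym)
  interpret H: subgroup H G by fact
  have hc: "h \<in> carrier G" using assms by auto
  show "card {x \<in> centralizer G H (h \<otimes> y \<otimes> inv h). x [^] v = \<one>}
    \<le> card {x \<in> centralizer G H y. x [^] v = \<one>}"
    using card_centralizer_pow_conj_le[OF assms(1,2), of "inv h" "h \<otimes> y \<otimes> inv h" v] assms hc
    by (simp add: inv_conj_conj)
qed (rule card_centralizer_pow_conj_le[OF assms])

text \<open>Each \<open>h\<close> is a unique product of commuting \<open>y\<close> and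
  \<open>x\<close> with \<open>y [^] u = \<one>\<close> and \<open>x [^] v = \<one>\<close>, and the
  choice of \<open>e\<close> makes \<open>h [^] e\<close> the factor \<open>y\<close>. The right
  side groups the elements by this u-part.\<close>

lemma sum_hall_decomposition:
  fixes c :: "'a \<Rightarrow> nat"
  assumes "subgroup H G" "finite (carrier G)" "order G = u * v"
    and e: "[e = 1] (mod u)" "[e = 0] (mod v)"
  shows "(\<Sum>h\<in>H. c (h [^] e))
    = (\<Sum>y\<in>{y \<in> H. y [^] u = \<one>}. c y * card {x \<in> centralizer G H y. x [^] v = \<one>})"
proof -
  interpret H: subgroup H G by fact
  have fin: "finite H" using assms(2) H.subset finite_subset by blast
  let ?P = "{y \<in> H. y [^] u = \<one>}"
  have pn: "x [^] (u * v) = \<one>" if "x \<in> carrier G" for x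
    using pow_order_eq_1[OF that] assms(3) by simp
  have im: "(\<lambda>h. h [^] e) ` H \<subseteq> ?P"
  proof safe
    fix h assume h: "h \<in> H"
    show "h [^] e \<in> H" using h by (rule subgroup_pow_closed[OF assms(1)])
    obtain k where "e = v * k" using e(2) by (auto simp: cong_0_iff)
    then have "h [^] (e * u) = (h [^] (u * v)) [^] k" using h by (simp add: nat_pow_pow ac_simps)
    then show "(h [^] e) [^] u = \<one>" using h pn[of h] by (simp add: nat_pow_pow)
  qed
  have "(\<Sum>h\<in>H. c (h [^] e)) = (\<Sum>y\<in>?P. \<Sum>h\<in>{h \<in> H. h [^] e = y}. c (h [^] e))"
    using sum.group[OF fin _ im, of "\<lambda>h. c (h [^] e)"] fin by simp
  also have "\<dots> = (\<Sum>y\<in>?P. c y * card {h \<in> H. h [^] e = y})"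
    by (rule sum.cong) simp_all
  also have "\<dots> = (\<Sum>y\<in>?P. c y * card {x \<in> centralizer G H y. x [^] v = \<one>})"
  proof (rule sum.cong[OF refl], rule arg_cong[of _ _ "\<lambda>k. _ * k"])
    fix y assume y: "y \<in> ?P"
    then have yc: "y \<in> carrier G" "y \<in> H" by auto
    have "bij_betw (\<lambda>x. y \<otimes> x) {x \<in> centralizer G H y. x [^] v = \<one>} {h \<in> H. h [^] e = y}"
    proof (rule bij_betwI', unfold mem_Collect_eq centralizer_def)
      fix a b assume "(a \<in> H \<and> a \<otimes> y = y \<otimes> a) \<and> a [^] v = \<one>"
        "(b \<in> H \<and> b \<otimes> y = y \<otimes> b) \<and> b [^] v = \<one>"
      then have "a \<in> carrier G" "b \<in> carrier G" by simp_all
      with yc(1) show "(y \<otimes> a = y \<otimes> b) = (a = b)" by simp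
    next
      fix x assume x: "(x \<in> H \<and> x \<otimes> y = y \<otimes> x) \<and> x [^] v = \<one>"
      then have xc: "x \<in> carrier G" by simp
      have "(y \<otimes> x) [^] e = y [^] e \<otimes> x [^] e"
        using x by (intro pow_mult_distrib yc xc) simp
      also have "y [^] e = y [^] (1::nat)" using y by (intro pow_cong[OF yc(1) _ e(1)]) simp
      also have "x [^] e = x [^] (0::nat)" using x by (intro pow_cong[OF xc _ e(2)]) simp
      finally have "(y \<otimes> x) [^] e = y" using yc(1) by simp
      moreover have "y \<otimes> x \<in> H" using x yc(2) by simp
      ultimately show "y \<otimes> x \<in> H \<and> (y \<otimes> x) [^] e = y" by blast
    next
      fix h assume h': "h \<in> H \<and> h [^] e = y"
      then have h: "h \<in> carrier G" by simp
      have he: "h [^] e = y" using h' by simp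
      \<comment> \<open>The complementary v-part; it commutes with \<open>y\<close> because
        \<open>y\<close> is a power of \<open>h\<close>.\<close>
      define x where "x = inv y \<otimes> h"
      have hy: "y \<otimes> h = h \<otimes> y"
        using nat_pow_comm[OF h, of 1 e] h unfolding he by simp
      have hiy: "inv y \<otimes> h = h \<otimes> inv y"
        by (rule inv_commute[OF yc(1) h hy])
      have hx: "y \<otimes> x = h" unfolding x_def using h yc(1) by (simp flip: m_assoc)
      have xy: "x \<otimes> y = h" unfolding x_def hiy using h yc(1) by (simp add: m_assoc)
      have "x [^] v = inv y [^] v \<otimes> h [^] v"
        unfolding x_def by (rule pow_mult_distrib[OF hiy]) (use h yc in simp_all)
      also have "inv y [^] v = inv (h [^] (e * v))"
        using h yc(1) unfolding he[symmetric] by (simp add: nat_pow_inv nat_pow_pow)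
      also have "h [^] (e * v) = h [^] (1 * v)"
      proof (rule pow_cong[OF h pn[OF h]])
        show "[e * v = 1 * v] (mod u * v)"
          unfolding cong_def by (simp only: mult_mod_left[symmetric] e(1)[unfolded cong_def])
      qed
      finally have "x [^] v = \<one>" using h by simp
      moreover have "x \<in> H" unfolding x_def using h' yc(2) by simp
      ultimately show "\<exists>x\<in>{x. (x \<in> H \<and> x \<otimes> y = y \<otimes> x) \<and> x [^] v = \<one>}. h = y \<otimes> x"
        using hx xy by (intro bexI[of _ x]) simp_all
    qed
    then show "card {h \<in> H. h [^] e = y} = card {x \<in> centralizer G H y. x [^] v = \<one>}"
      by (rule bij_betw_same_card[symmetric])
  qed
  finally show ?thesis .
qed


text \<open>Induction on \<open>|H|\<close>: split \<open>|H|\<close> according to the \<open>u\<close>-part \<open>y\<close> of an element. Classes of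
  noncentral \<open>y\<close> contribute multiples of \<open>k\<close> by induction, and every central \<open>y\<close> contributes the
  number sought; the number of these \<open>y\<close> is coprime to \<open>k\<close>.\<close>

theorem dvd_card_hall:
  assumes "subgroup H G" "finite (carrier G)" "order G = u * v" "coprime u v"
    "k dvd card H" "coprime k u"
  shows "k dvd card {x \<in> H. x [^] v = \<one>}"
  using assms(1,5,6)
proof (induction "card H" arbitrary: H k rule: less_induct)
  case less
  interpret H: subgroup H G by fact
  have fin: "finite H" using assms(2) H.subset finite_subset by blast
  let ?R = "\<lambda>y. card {x \<in> centralizer G H y. x [^] v = \<one>}"
  let ?P = "{y \<in> H. y [^] u = \<one>}"
  let ?Z = "{y \<in> ?P. centralizer G H y = H}"
  obtain e where e: "[e = 1] (mod u)" "[e = 0] (mod v)"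
    using binary_chinese_remainder_nat[OF assms(4), of 1 0] by blast
  have "card H = (\<Sum>y\<in>?P. ?R y)"
    using sum_hall_decomposition[OF less.prems(1) assms(2,3) e, of "\<lambda>_. 1"]
    by (simp only: mult_1 card_eq_sum)
  also have "\<dots> = (\<Sum>y\<in>?P - ?Z. ?R y) + (\<Sum>y\<in>?Z. ?R y)"
    using fin by (intro sum.subset_diff) auto
  also have "(\<Sum>y\<in>?Z. ?R y) = card ?Z * card {x \<in> H. x [^] v = \<one>}"
  proof -
    have "(\<Sum>y\<in>?Z. ?R y) = (\<Sum>y\<in>?Z. card {x \<in> H. x [^] v = \<one>})"
      by (rule sum.cong[OF refl]) simp
    then show ?thesis by simp
  qed
  finally have split: "card H = (\<Sum>y\<in>?P - ?Z. ?R y) + card ?Z * card {x \<in> H. x [^] v = \<one>}" .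
  have "k dvd (\<Sum>y\<in>?P - ?Z. ?R y)"
  proof (rule dvd_sum_class_function[OF less.prems(1)])
    show "finite (?P - ?Z)" "?P - ?Z \<subseteq> carrier G" using fin by auto
  next
    fix h x assume h: "h \<in> H" and x: "x \<in> ?P - ?Z"
    have c: "h \<in> carrier G" "x \<in> carrier G" using h x by auto
    show "h \<otimes> x \<otimes> inv h \<in> ?P - ?Z"
    proof (intro DiffI notI)
      show "h \<otimes> x \<otimes> inv h \<in> ?P" using h x c by (simp add: conj_pow)
      assume "h \<otimes> x \<otimes> inv h \<in> ?Z"
      then have Z: "centralizer G H (h \<otimes> x \<otimes> inv h) = H" by simp
      \<comment> \<open>If the conjugate commutes with all of \<open>H\<close>, it commutes with
        \<open>h\<close> in particular; conjugation by \<open>h\<close> then fixes it, so it was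
        \<open>x\<close> all along, contrary to the choice of \<open>x\<close>.\<close>
      have "h \<in> centralizer G H (h \<otimes> x \<otimes> inv h)" using Z h by simp
      then have "h \<otimes> (h \<otimes> x \<otimes> inv h) \<otimes> inv h = h \<otimes> x \<otimes> inv h"
        using c by (subst conj_eq_iff) (auto simp: centralizer_def)
      then have "h \<otimes> x \<otimes> inv h = x" using c by (simp only: conj_inject m_closed inv_closed)
      then show False using Z x by auto
    qed
    show "?R (h \<otimes> x \<otimes> inv h) = ?R x"
      using card_centralizer_pow_conj[OF less.prems(1) fin h c(2)] .
  next
    fix x assume x: "x \<in> ?P - ?Z"
    have c: "x \<in> carrier G" using x by auto
    let ?C = "centralizer G H x"
    have C: "subgroup ?C G" "?C \<subset> H"
      using subgroup_centralizer[OF less.prems(1) c] x by (auto simp: centralizer_def)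
    have cc: "card (conj_class G H x) * card ?C = card H"
      by (rule card_conj_class_centralizer[OF less.prems(1) c fin])
    \<comment> \<open>\<open>k\<close> need not divide \<open>card ?C\<close>, so the induction
      hypothesis is used for their gcd. The class size makes up for the loss: class size times this
      gcd is the gcd of class size times \<open>k\<close> and \<open>card H\<close>, both multiples
      of \<open>k\<close>.\<close>
    have "gcd k (card ?C) dvd ?R x"
      using coprime_divisors[OF gcd_dvd1 dvd_refl less.prems(3)]
      by (intro less.hyps[OF psubset_card_mono[OF fin C(2)] C(1)]) auto
    then have "card (conj_class G H x) * gcd k (card ?C) dvd card (conj_class G H x) * ?R x"
      by simp
    moreover have "k dvd card (conj_class G H x) * gcd k (card ?C)"
      unfolding gcd_mult_distrib_nat cc using less.prems(2) by simp
    ultimately show "k dvd card (conj_class G H x) * ?R x" by (rule dvd_trans[rotated])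
  qed
  then have "k dvd card ?Z * card {x \<in> H. x [^] v = \<one>}"
    by (rule dvd_add_right_iff[THEN iffD1, OF _ less.prems(2)[unfolded split]])
  \<comment> \<open>The central elements of \<open>H\<close> killed by \<open>u\<close> form a
    subgroup, so Cauchy's theorem confines the primes in its order to those of
    \<open>u\<close>.\<close>
  moreover have "coprime k (card ?Z)"
  proof (rule coprime_card_subgroup[where u = u])
    have ZC: "a \<in> centralizer G H h" if "a \<in> ?Z" "h \<in> H" for a h
    proof -
      have "a \<in> H" "h \<in> centralizer G H a" using that by simp_all
      then show ?thesis by (simp add: centralizer_def)
    qed
    show "subgroup ?Z G"
    proof (rule subgroupI)
      show "?Z \<subseteq> carrier G" by auto
      have "centralizer G H \<one> = H" by (auto simp: centralizer_def)
      then have "\<one> \<in> ?Z" by simp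
      then show "?Z \<noteq> {}" by blast
    next
      fix a assume a: "a \<in> ?Z"
      then have "a \<in> H" by simp
      then have ac: "a \<in> carrier G" by simp
      have "h \<in> centralizer G H (inv a)" if h: "h \<in> H" for h
      proof -
        have "a \<in> centralizer G H h" by (rule ZC[OF a h])
        then have "inv a \<in> centralizer G H h"
          using subgroup_centralizer[OF less.prems(1), of h] h subgroup.m_inv_closed by auto
        then show ?thesis using h by (auto simp: centralizer_def)
      qed
      moreover have "centralizer G H (inv a) \<subseteq> H" by (auto simp: centralizer_def)
      ultimately show "inv a \<in> ?Z" using a ac by (simp add: nat_pow_inv) blast
      fix b assume b: "b \<in> ?Z"
      then have "b \<in> H" by simp
      then have bc: "b \<in> carrier G" by simp
      have "h \<in> centralizer G H (a \<otimes> b)" if h: "h \<in> H" for h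
      proof -
        have "a \<in> centralizer G H h" "b \<in> centralizer G H h" by (rule ZC[OF _ h], fact)+
        then have "a \<otimes> b \<in> centralizer G H h"
          using subgroup_centralizer[OF less.prems(1), of h] h subgroup.m_closed by auto
        then show ?thesis using h by (auto simp: centralizer_def)
      qed
      moreover have "(a \<otimes> b) [^] u = \<one>"
      proof -
        have "a \<otimes> b = b \<otimes> a" using ZC[OF a, of b] b by (simp add: centralizer_def[of G _ b])
        then show ?thesis using pow_mult_distrib[OF _ ac bc] a b by simp
      qed
      moreover have "centralizer G H (a \<otimes> b) \<subseteq> H" by (auto simp: centralizer_def)
      ultimately show "a \<otimes> b \<in> ?Z" using a b by simp blast
    qed
  qed (use fin less.prems(3) in auto)
  ultimately show ?case by (simp add: coprime_dvd_mult_right_iff)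
qed

text \<open>For \<open>c\<close> the indicator of \<open>\<one>\<close> this is Frobenius's theorem
  on the solutions of \<open>x [^] v = \<one>\<close>, with \<open>v\<close> a Hall divisor. In
  general a class of u-parts \<open>y\<close> contributes its size times a count in the centralizer
  of \<open>y\<close>; \<open>dvd_card_hall\<close> makes that count a multiple of the gcd of
  \<open>v\<close> and the centralizer order, and the class size supplies the rest of
  \<open>v\<close>.\<close>

theorem dvd_sum_class_function_pow:
  fixes c :: "'a \<Rightarrow> nat"
  assumes "finite (carrier G)" "order G = u * v" "coprime u v"
    and e: "[e = 1] (mod u)" "[e = 0] (mod v)"
    and c: "\<And>h x. h \<in> carrier G \<Longrightarrow> x \<in> carrier G \<Longrightarrow> c (h \<otimes> x \<otimes> inv h) = c x"
  shows "v dvd (\<Sum>h\<in>carrier G. c (h [^] e))"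
  unfolding sum_hall_decomposition[OF subgroup_self assms(1,2) e, of c]
proof (rule dvd_sum_class_function[OF subgroup_self], goal_cases)
  case (5 x)
  then have x: "x \<in> carrier G" by auto
  let ?C = "centralizer G (carrier G) x"
  have sub: "subgroup ?C G" by (rule subgroup_centralizer[OF subgroup_self x])
  have cc: "card (conj_class G (carrier G) x) * card ?C = u * v"
    using card_conj_class_centralizer[OF subgroup_self x assms(1)] assms(2) by (simp add: order_def)
  have cop: "coprime (gcd v (card ?C)) u"
    using assms(3) coprime_divisors[OF gcd_dvd1 dvd_refl, of v u] by (simp add: coprime_commute)
  have "gcd v (card ?C) dvd card {y \<in> ?C. y [^] v = \<one>}"
    by (rule dvd_card_hall[OF sub assms(1-3) gcd_dvd2 cop])
  then have "card (conj_class G (carrier G) x) * gcd v (card ?C)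
      dvd card (conj_class G (carrier G) x) * card {y \<in> ?C. y [^] v = \<one>}" by simp
  moreover have "v dvd card (conj_class G (carrier G) x) * gcd v (card ?C)"
    unfolding gcd_mult_distrib_nat cc by simp
  ultimately show ?case by (subst mult.left_commute) (rule dvd_mult[OF dvd_trans])
next
  case (4 h x)
  then show ?case using c card_centralizer_pow_conj[OF subgroup_self assms(1)] by simp
qed (use assms(1) in \<open>auto simp: conj_pow\<close>)

end

section \<open>Exponents of the product of the element orders\<close>

lemma even_sum_involution:
  fixes f :: "'a \<Rightarrow> nat"
  assumes "finite X" "\<And>x. x \<in> X \<Longrightarrow> i x \<in> X" "\<And>x. x \<in> X \<Longrightarrow> i (i x) = x"
    "\<And>x. x \<in> X \<Longrightarrow> i x \<noteq> x" "\<And>x. x \<in> X \<Longrightarrow> f (i x) = f x"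
  shows "even (sum f X)"
  using assms
proof (induction "card X" arbitrary: X rule: less_induct)
  case less
  show ?case
  proof (cases "X = {}")
    case False
    then obtain x where x: "x \<in> X" by blast
    let ?Y = "X - {x, i x}"
    have ix: "i x \<in> X" "i x \<noteq> x" "i (i x) = x" using less.prems x by auto
    have "even (sum f ?Y)"
    proof (rule less.hyps)
      show "card ?Y < card X" using x less.prems(1) by (intro psubset_card_mono) auto
      fix y assume y: "y \<in> ?Y"
      have "i y \<noteq> x" "i y \<noteq> i x" using y ix less.prems(3)[of y] less.prems(3)[of x] x by auto
      then show "i y \<in> ?Y" using y less.prems(2) by auto
    qed (use less.prems in auto)
    moreover have "sum f X = sum f ?Y + sum f {x, i x}"
      using x ix less.prems(1) by (intro sum.subset_diff) auto
    moreover have "sum f {x, i x} = 2 * f x" using ix less.prems(5)[OF x] by simp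
    ultimately show ?thesis by simp
  qed simp
qed

context group
begin

lemma ord_conj:
  assumes "h \<in> carrier G" "x \<in> carrier G"
  shows "ord (h \<otimes> x \<otimes> inv h) = ord x"
proof -
  have "h \<otimes> y \<otimes> inv h = \<one> \<longleftrightarrow> y = \<one>" if "y \<in> carrier G" for y
    using conj_inject[OF assms(1) that one_closed] assms(1) by simp
  then show ?thesis using assms by (simp add: ord_unique conj_pow pow_eq_id)
qed

lemma ord_nonzero:
  assumes "finite (carrier G)" "x \<in> carrier G"
  shows "ord x \<noteq> 0"
  using ord_ge_1[OF assms] by simp

lemma multiplicity_rho:
  assumes "finite (carrier G)" "prime p"
  shows "multiplicity p (rho G) = (\<Sum>g\<in>carrier G. multiplicity p (ord g))"
  unfolding rho_def using assms
  by (intro prime_elem_multiplicity_prod_distrib) (auto dest: ord_nonzero[OF assms(1)])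

lemma rho_nonzero: "finite (carrier G) \<Longrightarrow> rho G \<noteq> 0"
  unfolding rho_def using ord_nonzero by simp

lemma prime_dvd_rho_imp_dvd_order:
  assumes "finite (carrier G)" "prime p" "p dvd rho G"
  shows "p dvd order G"
proof -
  obtain g where "g \<in> carrier G" "p dvd ord g"
    using assms unfolding rho_def by (auto simp: prime_dvd_prod_iff)
  then show ?thesis using ord_dvd_group_order dvd_trans by blast
qed

lemma even_multiplicity_rho:
  assumes "finite (carrier G)" "prime p" "odd p"
  shows "even (multiplicity p (rho G))"
proof -
  let ?X = "{g \<in> carrier G. p dvd ord g}"
  have "even (\<Sum>g\<in>?X. multiplicity p (ord g))"
  proof (rule even_sum_involution[where i = "m_inv G"])
    fix x assume x: "x \<in> ?X"
    show "inv x \<noteq> x"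
    proof
      assume "inv x = x"
      then have "x [^] (2::nat) = \<one>" using x r_inv[of x] by (simp add: numeral_2_eq_2)
      then have "ord x dvd 2" using x pow_eq_id by simp
      then have "p dvd 2" using x dvd_trans by blast
      then show False using assms(2,3) primes_dvd_imp_eq[OF _ two_is_prime_nat] by auto
    qed
  qed (use assms in auto)
  moreover have "(\<Sum>g\<in>carrier G. multiplicity p (ord g)) = (\<Sum>g\<in>?X. multiplicity p (ord g))"
    using assms(1) by (intro sum.mono_neutral_right) (auto simp: not_dvd_imp_multiplicity_0)
  ultimately show ?thesis using multiplicity_rho[OF assms(1,2)] by simp
qed

lemma multiplicity_rho_eq_card:
  assumes "finite (carrier G)" "prime p" "\<And>g. g \<in> carrier G \<Longrightarrow> multiplicity p (ord g) \<le> 1"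
  shows "multiplicity p (rho G) = card {g \<in> carrier G. p dvd ord g}"
proof -
  have "multiplicity p (ord g) = of_bool (p dvd ord g)" if g: "g \<in> carrier G" for g
  proof (cases "p dvd ord g")
    case True
    then have "multiplicity p (ord g) > 0"
      using ord_nonzero[OF assms(1) g] assms(2) by (simp add: prime_multiplicity_gt_zero_iff)
    then show ?thesis using assms(3)[OF g] True by simp
  qed (simp add: not_dvd_imp_multiplicity_0)
  then have "multiplicity p (rho G) = (\<Sum>g\<in>carrier G. of_bool (p dvd ord g))"
    unfolding multiplicity_rho[OF assms(1,2)] by simp
  also have "\<dots> = card {g \<in> carrier G. p dvd ord g}"
    using assms(1) by (simp add: Int_def)
  finally show ?thesis .
qed

text \<open>Unless \<open>a = 0\<close>, the exponent \<open>e\<close> is prime to \<open>p\<close>,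
  so raising to it removes from the order only factors prime to \<open>p\<close>. Hence the
  multiplicity depends on the p-part alone.\<close>

lemma multiplicity_ord_pow_hall:
  assumes "finite (carrier G)" "prime p" "order G = p ^ a * v" "\<not> p dvd v"
    and e: "[e = 1] (mod (p ^ a))" and g: "g \<in> carrier G"
  shows "multiplicity p (ord (g [^] e)) = multiplicity p (ord g)"
proof (cases "a = 0")
  case True
  have "\<not> p dvd ord h" if "h \<in> carrier G" for h
    using ord_dvd_group_order[OF that] assms(3,4) True dvd_trans by auto
  then show ?thesis using g by (simp add: not_dvd_imp_multiplicity_0)
next
  case False
  then have "[e = 1] (mod p)" by (intro cong_dvd_modulus_nat[OF e]) simp
  then have pe: "\<not> p dvd e"
    using assms(2) by (metis cong_dvd_iff not_prime_unit)
  then have "e \<noteq> 0" by (intro notI) simp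
  let ?d = "gcd (ord g) e"
  have d: "\<not> p dvd ?d" using pe by simp
  obtain k where k: "ord g = ?d * k" using gcd_dvd1 by (metis dvdE)
  have "k \<noteq> 0" "?d \<noteq> 0" using k ord_nonzero[OF assms(1) g] by (metis mult_0_right mult_0)+
  have "ord (g [^] e) = ord g div ?d" using ord_pow_gen[OF g] \<open>e \<noteq> 0\<close> by simp
  also have "\<dots> = k" using k \<open>?d \<noteq> 0\<close> by (metis nonzero_mult_div_cancel_left)
  finally have "multiplicity p (ord (g [^] e)) = multiplicity p k" by simp
  also have "\<dots> = multiplicity p (?d * k)"
    using assms(2) \<open>k \<noteq> 0\<close> \<open>?d \<noteq> 0\<close> d
    by (simp add: prime_elem_multiplicity_mult_distrib not_dvd_imp_multiplicity_0)
  also have "\<dots> = multiplicity p (ord g)" by (simp only: k[symmetric])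
  finally show ?thesis .
qed

lemma prime_dvd_ord_pow_hall:
  assumes "finite (carrier G)" "prime p" "order G = p ^ a * v" "\<not> p dvd v"
    and "[e = 1] (mod (p ^ a))" and g: "g \<in> carrier G"
  shows "p dvd ord (g [^] e) \<longleftrightarrow> p dvd ord g"
proof -
  have "p dvd ord h \<longleftrightarrow> multiplicity p (ord h) > 0" if "h \<in> carrier G" for h
    using ord_nonzero[OF assms(1) that] assms(2) by (simp add: prime_multiplicity_gt_zero_iff)
  then show ?thesis using multiplicity_ord_pow_hall[OF assms] g by simp
qed

lemma hall_exponent:
  assumes "prime p" "\<not> p dvd (v::nat)"
  obtains e :: nat where "[e = 1] (mod (p ^ a))" "[e = 0] (mod v)"
proof -
  have "coprime (p ^ a) v" using prime_imp_coprime[OF assms] by simp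
  then show ?thesis using binary_chinese_remainder_nat[of "p ^ a" v 1 0] that by blast
qed

lemma dvd_multiplicity_rho:
  assumes "finite (carrier G)" "prime p" "order G = p ^ a * v" "\<not> p dvd v"
  shows "v dvd multiplicity p (rho G)"
proof -
  obtain e where e: "[e = 1] (mod (p ^ a))" "[e = 0] (mod v)"
    using hall_exponent[OF assms(2,4)] .
  have "coprime (p ^ a) v" using prime_imp_coprime[OF assms(2,4)] by simp
  from dvd_sum_class_function_pow[OF assms(1,3) this e, of "\<lambda>x. multiplicity p (ord x)"]
  show ?thesis using multiplicity_ord_pow_hall[OF assms e(1)] ord_conj
    by (simp add: multiplicity_rho[OF assms(1,2)])
qed

text \<open>The class function is an indicator here. This serves for the elements of order divisible
  by \<open>p\<close>, and later for a single class of involutions.\<close>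

lemma dvd_card_conj_closed:
  assumes "finite (carrier G)" "prime p" "order G = p ^ a * v" "\<not> p dvd v"
    and e: "[e = 1] (mod (p ^ a))" "[e = 0] (mod v)"
    and X: "X \<subseteq> carrier G" "\<And>h x. h \<in> carrier G \<Longrightarrow> x \<in> carrier G \<Longrightarrow> h \<otimes> x \<otimes> inv h \<in> X \<longleftrightarrow> x \<in> X"
  shows "v dvd card {g \<in> carrier G. g [^] e \<in> X}"
proof -
  have "coprime (p ^ a) v" using prime_imp_coprime[OF assms(2,4)] by simp
  from dvd_sum_class_function_pow[OF assms(1,3) this e, of "\<lambda>x. of_bool (x \<in> X)"]
  have "v dvd (\<Sum>g\<in>carrier G. of_bool (g [^] e \<in> X))" using X(2) by simp
  then show ?thesis using assms(1) by (simp add: Int_def)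
qed

lemma dvd_card_prime_dvd_ord:
  assumes "finite (carrier G)" "prime p" "order G = p ^ a * v" "\<not> p dvd v"
  shows "v dvd card {g \<in> carrier G. p dvd ord g}"
proof -
  obtain e where e: "[e = 1] (mod (p ^ a))" "[e = 0] (mod v)"
    using hall_exponent[OF assms(2,4)] .
  have "{g \<in> carrier G. p dvd ord g} = {g \<in> carrier G. g [^] e \<in> {g \<in> carrier G. p dvd ord g}}"
    using prime_dvd_ord_pow_hall[OF assms e(1)] by auto
  moreover have "v dvd card {g \<in> carrier G. g [^] e \<in> {g \<in> carrier G. p dvd ord g}}"
    by (rule dvd_card_conj_closed[OF assms e]) (auto simp: ord_conj)
  ultimately show ?thesis by argo
qed

end

section \<open>Isomorphism invariance and the exponents of cyclic groups\<close>

lemma (in group) ord_inj_hom: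
  assumes "group H" "h \<in> hom G H" "inj_on h (carrier G)" "x \<in> carrier G"
  shows "group.ord H (h x) = ord x"
proof -
  interpret H: group H by fact
  interpret group_hom G H h using assms(2) by unfold_locales
  have "h x [^]\<^bsub>H\<^esub> n = \<one>\<^bsub>H\<^esub> \<longleftrightarrow> ord x dvd n" for n :: nat
  proof -
    have "h x [^]\<^bsub>H\<^esub> n = \<one>\<^bsub>H\<^esub> \<longleftrightarrow> h (x [^] n) = h \<one>" using assms(4) by (simp add: hom_nat_pow)
    also have "\<dots> \<longleftrightarrow> x [^] n = \<one>" using assms(3,4) by (intro inj_on_eq_iff) auto
    finally show ?thesis using assms(4) by (simp add: pow_eq_id)
  qed
  then show ?thesis using assms(4) by (subst H.ord_unique) auto
qed

lemma rho_iso: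
  assumes "group G" "group H" "G \<cong> H"
  shows "rho G = rho H"
proof -
  from assms(3) obtain h where h: "h \<in> hom G H" "bij_betw h (carrier G) (carrier H)"
    by (auto simp: is_iso_def iso_def)
  have "rho G = (\<Prod>g\<in>carrier G. group.ord H (h g))"
    unfolding rho_def using group.ord_inj_hom[OF assms(1,2) h(1)] h(2)
    by (intro prod.cong) (auto simp: bij_betw_def)
  also have "\<dots> = rho H" unfolding rho_def by (rule prod.reindex_bij_betw[OF h(2)])
  finally show ?thesis .
qed

lemma (in group) iso_integer_mod_group:
  assumes "g \<in> carrier G" "ord g = order G" "finite (carrier G)"
  shows "G \<cong> integer_mod_group (order G)"
proof -
  let ?n = "order G" and ?h = "\<lambda>k. g [^] nat k"
  have n: "?n > 0" using assms(3) order_gt_0_iff_finite by simp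
  have car: "carrier (integer_mod_group ?n) = {0..<int ?n}"
    using n by (simp add: carrier_integer_mod_group)
  have pn: "g [^] ?n = \<one>" using assms(1) pow_order_eq_1 by simp
  have "?h \<in> hom (integer_mod_group ?n) G"
  proof (rule homI)
    fix x y assume "x \<in> carrier (integer_mod_group ?n)" "y \<in> carrier (integer_mod_group ?n)"
    then have xy: "0 \<le> x" "0 \<le> y" by (auto simp: car)
    have "nat ((x + y) mod int ?n) = (nat x + nat y) mod ?n"
      using xy by (simp add: nat_mod_distrib nat_add_distrib)
    then have "[nat ((x + y) mod int ?n) = nat x + nat y] (mod ?n)" by (simp add: cong_def)
    then have "?h ((x + y) mod int ?n) = g [^] (nat x + nat y)" by (rule pow_cong[OF assms(1) pn])
    then show "?h (x \<otimes>\<^bsub>integer_mod_group ?n\<^esub> y) = ?h x \<otimes> ?h y"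
      using assms(1) by (simp add: nat_pow_mult)
  qed (use assms(1) in simp)
  moreover have inj: "inj_on ?h {0..<int ?n}"
  proof (rule inj_onI)
    fix x y assume xy: "x \<in> {0..<int ?n}" "y \<in> {0..<int ?n}" "?h x = ?h y"
    have "nat x = nat y"
      using xy n by (intro inj_onD[OF ord_inj[OF assms(1)] xy(3)]) (auto simp: assms(2))
    then show "x = y" using xy by auto
  qed
  moreover have "?h ` {0..<int ?n} = carrier G"
    using card_image[OF inj] assms(1,3) by (intro card_subset_eq) (auto simp: order_def)
  ultimately have "?h \<in> iso (integer_mod_group ?n) G"
    by (auto simp: iso_def bij_betw_def car)
  then have "integer_mod_group ?n \<cong> G" by (auto simp: is_iso_def)
  then show ?thesis by (rule group.iso_sym[OF group_integer_mod_group])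
qed

text \<open>As \<open>p\<close> divides \<open>n\<close> exactly once, the order of \<open>x\<close>
  is prime to \<open>p\<close> iff \<open>k * x\<close> vanishes modulo \<open>p * k\<close>, that
  is, iff \<open>x\<close> is a multiple of \<open>p\<close>; there are \<open>k\<close> such
  residues.\<close>

lemma card_integer_mod_group_prime_dvd_ord:
  assumes n: "n = p * k" and p: "prime p" "\<not> p dvd k"
  shows "card {x \<in> carrier (integer_mod_group n). p dvd group.ord (integer_mod_group n) x} = n - k"
proof -
  interpret group "integer_mod_group n" by simp
  have k: "k > 0" using p(2) by (intro Nat.gr0I) simp
  have n0: "n > 0" using n k prime_gt_0_nat[OF p(1)] by simp
  have car: "carrier (integer_mod_group n) = {0..<int n}"
    using n0 by (simp add: carrier_integer_mod_group)
  have fin: "finite (carrier (integer_mod_group n))" by (simp add: car)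
  have ord_n: "order (integer_mod_group n) = n" by (simp add: order_def car)
  have iff: "p dvd ord x \<longleftrightarrow> \<not> int p dvd x" if x: "x \<in> carrier (integer_mod_group n)" for x
  proof -
    have "ord x dvd p * k" using ord_dvd_group_order[OF x] ord_n n by simp
    have "\<not> p dvd ord x \<longleftrightarrow> ord x dvd k"
    proof
      assume "\<not> p dvd ord x"
      then have "coprime (ord x) p" using prime_imp_coprime[OF p(1)] coprime_commute by blast
      then show "ord x dvd k" using \<open>ord x dvd p * k\<close> by (simp add: coprime_dvd_mult_right_iff)
    qed (use p(2) dvd_trans in blast)
    also have "ord x dvd k \<longleftrightarrow> (int k * x) mod int n = 0"
      using pow_eq_id[OF x, of k] by simp
    also have "\<dots> \<longleftrightarrow> int p * int k dvd int k * x" by (simp add: n mod_eq_0_iff_dvd)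
    also have "\<dots> \<longleftrightarrow> int p dvd x" using k by (simp add: mult.commute)
    finally show ?thesis by blast
  qed
  have "card {x \<in> carrier (integer_mod_group n). int p dvd x} = k"
  proof -
    have p0: "0 < int p" using prime_gt_0_nat[OF p(1)] by simp
    have "bij_betw (\<lambda>j. int p * int j) {..<k} {x \<in> carrier (integer_mod_group n). int p dvd x}"
    proof (rule bij_betwI')
      fix j j' show "(int p * int j = int p * int j') = (j = j')" using p0 by simp
    next
      fix j assume "j \<in> {..<k}"
      then show "int p * int j \<in> {x \<in> carrier (integer_mod_group n). int p dvd x}"
        using p0 k by (simp add: carrier_integer_mod_group n)
    next
      fix x assume "x \<in> {x \<in> carrier (integer_mod_group n). int p dvd x}"
      then have x: "0 \<le> x" "x < int p * int k" "int p dvd x" unfolding car by (simp_all add: n)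
      obtain y where y: "x = int p * y" using x(3) by (rule dvdE)
      have "0 \<le> y" "y < int k" using p0 x(1,2) unfolding y
        by (simp_all add: zero_le_mult_iff)
      then show "\<exists>j\<in>{..<k}. x = int p * int j"
        using y by (intro bexI[of _ "nat y"]) auto
    qed
    then show ?thesis using bij_betw_same_card by fastforce
  qed
  moreover have "{x \<in> carrier (integer_mod_group n). p dvd ord x}
      = carrier (integer_mod_group n) - {x \<in> carrier (integer_mod_group n). int p dvd x}"
    using iff by auto
  ultimately show ?thesis using fin ord_n by (simp add: card_Diff_subset order_def)
qed

lemma multiplicity_rho_integer_mod_group:
  assumes n: "n = p * k" and p: "prime p" "\<not> p dvd k"
  shows "multiplicity p (rho (integer_mod_group n)) = n - k"
proof -
  interpret group "integer_mod_group n" by simp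
  have "k > 0" using p(2) by (intro Nat.gr0I) simp
  then have "n > 0" using n prime_gt_0_nat[OF p(1)] by simp
  then have fin: "finite (carrier (integer_mod_group n))"
    and ord_n: "order (integer_mod_group n) = n" by (simp_all add: carrier_integer_mod_group order_def)
  have "multiplicity p (ord x) \<le> 1" if x: "x \<in> carrier (integer_mod_group n)" for x
  proof -
    have "multiplicity p (ord x) \<le> multiplicity p n"
      using ord_dvd_group_order[OF x] ord_n \<open>n > 0\<close> by (intro dvd_imp_multiplicity_le) auto
    also have "multiplicity p n = 1"
      using p n \<open>k > 0\<close> by (simp add: prime_elem_multiplicity_mult_distrib not_dvd_imp_multiplicity_0)
    finally show ?thesis .
  qed
  from multiplicity_rho_eq_card[OF fin p(1) this]
  show ?thesis using card_integer_mod_group_prime_dvd_ord[OF n p] by simp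
qed

lemma Exp_rho_eq_image:
  assumes "group G" "finite (carrier G)" "\<And>p. prime p \<Longrightarrow> p dvd order G \<Longrightarrow> p \<in> P"
    "\<And>p. p \<in> P \<Longrightarrow> prime p \<and> multiplicity p (rho G) > 0"
  shows "Exp_rho G = (\<lambda>p. multiplicity p (rho G)) ` P"
proof -
  interpret group G by fact
  have nz: "rho G \<noteq> 0" by (rule rho_nonzero[OF assms(2)])
  have "prime_factors (rho G) = P"
  proof (intro subset_antisym subsetI)
    fix p assume "p \<in> prime_factors (rho G)"
    then show "p \<in> P" using prime_dvd_rho_imp_dvd_order[OF assms(2)] assms(3) by blast
  next
    fix p assume "p \<in> P"
    then show "p \<in> prime_factors (rho G)"
      using assms(4) nz prime_multiplicity_gt_zero_iff[of p "rho G"]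
      by (simp add: in_prime_factors_iff)
  qed
  then show ?thesis by (simp add: Exp_rho_def Exp_def)
qed

lemma Exp_rho_integer_mod_group:
  fixes q r :: nat
  assumes "prime q" "odd q" "prime r" "odd r" "q \<noteq> r"
  shows "Exp_rho (integer_mod_group (2 * q * r)) = {q * r, 2 * r * (q - 1), 2 * q * (r - 1)}"
proof -
  let ?n = "2 * q * r"
  have gt: "q > 1" "r > 1" using assms prime_gt_1_nat by auto
  have fin: "finite (carrier (integer_mod_group ?n))" and ord_n: "order (integer_mod_group ?n) = ?n"
    using gt by (simp_all add: carrier_integer_mod_group order_def del: of_nat_mult)
  have nd: "\<not> q dvd r" "\<not> r dvd q" "\<not> q dvd 2" "\<not> r dvd 2"
    using assms primes_dvd_imp_eq two_is_prime_nat by (metis, metis, metis even_numeral, metis even_numeral)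
  have m2: "multiplicity 2 (rho (integer_mod_group ?n)) = q * r"
    using multiplicity_rho_integer_mod_group[of ?n 2 "q * r"] assms by simp
  have mq: "multiplicity q (rho (integer_mod_group ?n)) = 2 * r * (q - 1)"
    using multiplicity_rho_integer_mod_group[of ?n q "2 * r"] assms nd
    by (simp add: prime_dvd_mult_iff algebra_simps)
  have mr: "multiplicity r (rho (integer_mod_group ?n)) = 2 * q * (r - 1)"
    using multiplicity_rho_integer_mod_group[of ?n r "2 * q"] assms nd
    by (simp add: prime_dvd_mult_iff algebra_simps)
  have "Exp_rho (integer_mod_group ?n) = (\<lambda>p. multiplicity p (rho (integer_mod_group ?n))) ` {2, q, r}"
  proof (rule Exp_rho_eq_image[OF _ fin])
    fix p :: nat assume p: "prime p" "p dvd order (integer_mod_group ?n)"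
    then have "p dvd 2 \<or> p dvd q \<or> p dvd r" by (auto simp: ord_n prime_dvd_mult_iff)
    then show "p \<in> {2, q, r}" using p(1) assms primes_dvd_imp_eq two_is_prime_nat by blast
  qed (use assms gt m2 mq mr in auto)
  then show ?thesis using m2 mq mr by simp
qed

section \<open>Groups with the exponents of a cyclic group of order 2qr\<close>

lemma dvd_product_of_primes_trichotomy:
  fixes q r d :: nat
  assumes "prime q" "prime r" "d dvd q * r"
  shows "d = 1 \<or> d = q \<or> d = r \<or> d = q * r"
proof -
  obtain x y where xy: "d = x * y" "x dvd q" "y dvd r"
    using division_decomp[OF assms(3)] by blast
  then have "x = 1 \<or> x = q" "y = 1 \<or> y = r" using assms(1,2) by (auto simp: prime_nat_iff)
  then show ?thesis using xy(1) by auto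
qed

text \<open>What remains of the exponent hypothesis in pure counting terms. The conditions are
  symmetric in \<open>q\<close> and \<open>r\<close>, which \<open>swap\<close> exploits.\<close>

locale two_prime_exponent_group = group G for G (structure) +
  fixes q r a :: nat
  assumes fin: "finite (carrier G)"
    and primes: "prime q" "odd q" "prime r" "odd r" "q \<noteq> r"
    and order_eq: "order G = 2 ^ a * (q * r)"
    and card_2: "card {g \<in> carrier G. 2 dvd ord g} = q * r"
    and card_q: "card {g \<in> carrier G. q dvd ord g} = 2 * r * (q - 1)"
    and card_r: "card {g \<in> carrier G. r dvd ord g} = 2 * q * (r - 1)"
    and not_4_dvd_ord: "g \<in> carrier G \<Longrightarrow> \<not> 4 dvd ord g"

lemma (in group) multiplicity_ord_le_1:
  assumes "finite (carrier G)" "prime p" "order G = p * k" "\<not> p dvd k" "g \<in> carrier G"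
  shows "multiplicity p (ord g) \<le> 1"
proof -
  have n: "order G > 0" using assms(1) order_gt_0_iff_finite by simp
  then have "multiplicity p (ord g) \<le> multiplicity p (order G)"
    using ord_dvd_group_order[OF assms(5)] by (intro dvd_imp_multiplicity_le) auto
  also have "multiplicity p (order G) = 1"
    using assms n by (simp add: prime_elem_multiplicity_mult_distrib not_dvd_imp_multiplicity_0)
  finally show ?thesis .
qed

lemma (in group) two_prime_exponent_groupI:
  fixes q r :: nat
  assumes fin: "finite (carrier G)"
    and primes: "prime q" "odd q" "prime r" "odd r" "q \<noteq> r"
    and exp: "Exp_rho G = {q * r, 2 * r * (q - 1), 2 * q * (r - 1)}"
  shows "\<exists>a. two_prime_exponent_group G q r a"
proof -
  let ?m = "\<lambda>p. multiplicity p (rho G)"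
  have gt: "q > 2" "r > 2" using primes prime_gt_1_nat[of q] prime_gt_1_nat[of r]
    by (auto intro!: le_neq_implies_less simp: Suc_le_eq numeral_2_eq_2)
  have nd: "\<not> q dvd r" "\<not> r dvd q" "\<not> q dvd 2" "\<not> r dvd 2"
    using primes primes_dvd_imp_eq two_is_prime_nat by (metis, metis, metis even_numeral, metis even_numeral)
  have n0: "order G > 0" using fin order_gt_0_iff_finite by simp
  have ex: "\<exists>p. prime p \<and> p dvd order G \<and> ?m p = x" if "x \<in> Exp_rho G" for x
    using that prime_dvd_rho_imp_dvd_order[OF fin]
    by (auto simp: Exp_rho_def Exp_def in_prime_factors_iff)
  obtain p1 where p1: "prime p1" "p1 dvd order G" "?m p1 = q * r" using ex[of "q * r"] exp by auto
  obtain p2 where p2: "prime p2" "p2 dvd order G" "?m p2 = 2 * r * (q - 1)"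
    using ex[of "2 * r * (q - 1)"] exp by auto
  obtain p3 where p3: "prime p3" "p3 dvd order G" "?m p3 = 2 * q * (r - 1)"
    using ex[of "2 * q * (r - 1)"] exp by auto
  have "p1 = 2"
  proof (rule ccontr)
    assume "p1 \<noteq> 2"
    then have "odd p1" using p1(1) prime_odd_nat prime_ge_2_nat[OF p1(1)] by (metis le_neq_implies_less)
    then show False using even_multiplicity_rho[OF fin p1(1)] p1(3) primes by simp
  qed
  then have m2: "?m 2 = q * r" using p1 by simp
  \<comment> \<open>Guarantees that the two even values belong to two different primes, both of
    which then divide the odd part \<open>v\<close>.\<close>
  have "2 * r * (q - 1) \<noteq> 2 * q * (r - 1)"
  proof
    assume "2 * r * (q - 1) = 2 * q * (r - 1)"
    then have "r * q - r = q * r - q" by (simp add: algebra_simps)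
    moreover have "r \<le> r * q" "q \<le> r * q" using gt by simp_all
    ultimately have "q = r" unfolding mult.commute[of r q] by linarith
    then show False using primes by simp
  qed
  then have "p2 \<noteq> p3" using p2 p3 by auto
  have "p2 \<noteq> 2" "p3 \<noteq> 2" using p2(3) p3(3) m2 primes
    by (metis even_mult_iff dvd_triv_left mult.assoc)+
  obtain v where v: "order G = 2 ^ multiplicity 2 (order G) * v" "\<not> 2 dvd v"
    using multiplicity_decompose'[of "order G" 2] n0 by auto
  define a where "a = multiplicity 2 (order G)"
  note v = v[folded a_def]
  have vqr: "v dvd q * r"
    using dvd_multiplicity_rho[OF fin two_is_prime_nat v] m2 by simp
  have inv: "p dvd v" if "prime p" "p dvd order G" "p \<noteq> 2" for p
    using that v(1) by (metis prime_dvd_mult_iff prime_dvd_power primes_dvd_imp_eq two_is_prime_nat)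
  have "p2 dvd v" "p3 dvd v" using inv p2 p3 \<open>p2 \<noteq> 2\<close> \<open>p3 \<noteq> 2\<close> by auto
  have inqr: "p = q \<or> p = r" if "prime p" "p dvd v" for p
    using that vqr primes by (metis dvd_trans prime_dvd_mult_iff primes_dvd_imp_eq)
  have v_eq: "v = q * r"
    using dvd_product_of_primes_trichotomy[OF primes(1,3) vqr] \<open>p2 \<noteq> p3\<close>
      inqr[OF p2(1) \<open>p2 dvd v\<close>] inqr[OF p3(1) \<open>p3 dvd v\<close>] \<open>p2 dvd v\<close> \<open>p3 dvd v\<close> nd p2(1) not_prime_unit
    by (metis nat_dvd_1_iff_1)
  have order: "order G = 2 ^ a * (q * r)" using v(1) v_eq by simp
  \<comment> \<open>Otherwise \<open>r\<close> would have the exponent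
    \<open>2 * r * (q - 1)\<close>. The part of the order prime to \<open>r\<close> divides the
    exponent of \<open>r\<close>, so \<open>q\<close> would divide this number, which is
    impossible.\<close>
  have "p2 = q"
  proof (rule ccontr)
    assume "p2 \<noteq> q"
    then have "p2 = r" using inqr[OF p2(1) \<open>p2 dvd v\<close>] by simp
    have "\<not> r dvd 2 ^ a * q" using nd primes(3) by (metis prime_dvd_mult_iff prime_dvd_power)
    then have "2 ^ a * q dvd ?m r"
      using order by (intro dvd_multiplicity_rho[OF fin primes(3), of 1]) (simp_all add: ac_simps)
    then have "q dvd 2 * r * (q - 1)" using p2(3) \<open>p2 = r\<close> by (metis dvd_mult_right)
    then have "q dvd q - 1" using nd primes(1) by (metis prime_dvd_mult_iff)
    then show False using gt by (auto dest: dvd_imp_le)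
  qed
  then have "p3 = r" using inqr[OF p3(1) \<open>p3 dvd v\<close>] \<open>p2 \<noteq> p3\<close> by simp
  have mq: "?m q = 2 * r * (q - 1)" and mr: "?m r = 2 * q * (r - 1)"
    using p2(3) p3(3) \<open>p2 = q\<close> \<open>p3 = r\<close> by simp_all
  have cq: "card {g \<in> carrier G. q dvd ord g} = ?m q"
  proof (rule multiplicity_rho_eq_card[symmetric, OF fin primes(1) multiplicity_ord_le_1[OF fin primes(1)]])
    show "order G = q * (2 ^ a * r)" using order by (simp add: ac_simps)
    show "\<not> q dvd 2 ^ a * r" using nd primes(1) by (metis prime_dvd_mult_iff prime_dvd_power)
  qed
  have cr: "card {g \<in> carrier G. r dvd ord g} = ?m r"
  proof (rule multiplicity_rho_eq_card[symmetric, OF fin primes(3) multiplicity_ord_le_1[OF fin primes(3)]])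
    show "order G = r * (2 ^ a * q)" using order by (simp add: ac_simps)
    show "\<not> r dvd 2 ^ a * q" using nd primes(3) by (metis prime_dvd_mult_iff prime_dvd_power)
  qed
  let ?D = "{g \<in> carrier G. 2 dvd ord g}"
  have sum2: "(\<Sum>g\<in>?D. multiplicity 2 (ord g)) = q * r"
  proof -
    have "(\<Sum>g\<in>?D. multiplicity 2 (ord g)) = (\<Sum>g\<in>carrier G. multiplicity 2 (ord g))"
      using fin by (intro sum.mono_neutral_left) (auto simp: not_dvd_imp_multiplicity_0)
    then show ?thesis using multiplicity_rho[OF fin two_is_prime_nat] m2 by simp
  qed
  have finD: "finite ?D" using fin by simp
  have ge1: "1 \<le> multiplicity 2 (ord g)" if "g \<in> ?D" for g
    using that ord_nonzero[OF fin] prime_multiplicity_gt_zero_iff[of 2 "ord g"] by (auto simp: Suc_le_eq)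
  have le: "card ?D \<le> q * r"
    using sum_mono[of ?D "\<lambda>_. 1" "\<lambda>g. multiplicity 2 (ord g)"] ge1 sum2 by simp
  have "?D \<noteq> {}"
  proof
    assume "?D = {}"
    then have "q * r = 0" using sum2 by (metis sum.empty)
    then show False using gt by simp
  qed
  then have "card ?D > 0" using finD by (simp add: card_gt_0_iff)
  moreover have "q * r dvd card ?D"
    using dvd_card_prime_dvd_ord[OF fin two_is_prime_nat v] v_eq by simp
  ultimately have c2: "card ?D = q * r" using le by (auto dest: dvd_imp_le)
  have no4: "\<not> 4 dvd ord g" if g: "g \<in> carrier G" for g
  proof
    assume "4 dvd ord g"
    then have "2 ^ 2 dvd ord g" by simp
    then have m: "multiplicity 2 (ord g) \<ge> 2"
      using ord_nonzero[OF fin g] by (intro multiplicity_geI) auto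
    have gD: "g \<in> ?D" using g \<open>4 dvd ord g\<close> by (auto intro: dvd_trans[of 2 4])
    \<comment> \<open>\<open>q * r\<close> summands, all at least 1, already have sum
      \<open>q * r\<close>; a summand of 2 or more does not fit.\<close>
    have "(\<Sum>g\<in>?D. 1) < (\<Sum>g\<in>?D. multiplicity 2 (ord g))"
      using ge1 m gD by (intro sum_strict_mono_ex1[OF finD]) (auto intro!: bexI[of _ g])
    then show False using sum2 c2 by simp
  qed
  have "two_prime_exponent_group G q r a"
    using fin primes order c2 cq cr mq mr no4 by unfold_locales simp_all
  then show ?thesis ..
qed

context two_prime_exponent_group
begin

lemma gt_2: "q > 2" "r > 2"
  using primes prime_gt_1_nat[of q] prime_gt_1_nat[of r]
  by (auto intro!: le_neq_implies_less simp: Suc_le_eq numeral_2_eq_2)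

lemma not_dvd: "\<not> q dvd r" "\<not> r dvd q" "\<not> q dvd 2" "\<not> r dvd 2"
  using primes primes_dvd_imp_eq two_is_prime_nat by (metis, metis, metis even_numeral, metis even_numeral)

lemma swap: "two_prime_exponent_group G r q a"
  using fin primes order_eq card_2 card_q card_r not_4_dvd_ord
  by unfold_locales (simp_all add: mult.commute)

lemma prime_dvd_ord:
  assumes "g \<in> carrier G" "g \<noteq> \<one>"
  shows "2 dvd ord g \<or> q dvd ord g \<or> r dvd ord g"
proof -
  have "ord g \<noteq> 1" using assms ord_eq_1 by simp
  then obtain p where p: "prime p" "p dvd ord g" using prime_factor_nat by blast
  then have "p dvd 2 ^ a * (q * r)" using ord_dvd_group_order[OF assms(1)] order_eq dvd_trans by metis
  then have "p dvd 2 \<or> p dvd q \<or> p dvd r" using p(1) by (metis prime_dvd_mult_iff prime_dvd_power)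
  then have "p = 2 \<or> p = q \<or> p = r" using p(1) primes primes_dvd_imp_eq two_is_prime_nat by metis
  then show ?thesis using p(2) by blast
qed

lemma a_cases: "a = 1 \<or> a = 2"
proof -
  let ?D = "\<lambda>p. {g \<in> carrier G. p dvd ord g}"
  have "carrier G \<subseteq> {\<one>} \<union> ?D 2 \<union> ?D q \<union> ?D r" using prime_dvd_ord by blast
  then have "card (carrier G) \<le> card ({\<one>} \<union> ?D 2 \<union> ?D q \<union> ?D r)"
    using fin by (intro card_mono) auto
  also have "\<dots> \<le> 1 + card (?D 2) + card (?D q) + card (?D r)"
    using card_Un_le[of "{\<one>} \<union> ?D 2 \<union> ?D q" "?D r"] card_Un_le[of "{\<one>} \<union> ?D 2" "?D q"]
      card_Un_le[of "{\<one>}" "?D 2"] by simp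
  finally have "2 ^ a * (q * r) \<le> 1 + q * r + 2 * r * (q - 1) + 2 * q * (r - 1)"
    using card_2 card_q card_r order_eq by (simp add: order_def)
  \<comment> \<open>The bound equals \<open>5 * q * r - 2 * q - 2 * r + 1\<close>; writing
    \<open>q\<close> and \<open>r\<close> as successors removes the truncated subtractions.\<close>
  also have "\<dots> < 5 * (q * r)"
  proof -
    obtain q' r' where "q = Suc q'" "r = Suc r'" using gt_2 by (metis not0_implies_Suc not_less0)
    then show ?thesis using gt_2 by (simp add: algebra_simps)
  qed
  finally have "2 ^ a < (5::nat)" by simp
  have "a < 3"
  proof (rule ccontr)
    assume "\<not> a < 3"
    then have "(2::nat) ^ 3 \<le> 2 ^ a" by (intro power_increasing) auto
    then show False using \<open>2 ^ a < 5\<close> by simp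
  qed
  moreover have "a \<noteq> 0"
  proof
    assume "a = 0"
    then have "odd (order G)" using order_eq primes by simp
    then have "?D 2 = {}" using ord_dvd_group_order dvd_trans by blast
    then have "q * r = 0" using card_2 by (metis card.empty)
    then show False using gt_2 by simp
  qed
  ultimately show ?thesis by linarith
qed

text \<open>Count the pairs of a nonidentity element and a prime among 2, \<open>q\<close>,
  \<open>r\<close> dividing its order. There are \<open>5 * q * r - 2 * q - 2 * r\<close> of them,
  too many for each of the \<open>2 * q * r - 1\<close> elements to have at most two; an element
  with all three primes generates the group.\<close>

lemma cyclic_if_a_eq_1:
  assumes "a = 1"
  shows "G \<cong> integer_mod_group (2 * q * r)"
proof -
  let ?D = "\<lambda>p. {g \<in> carrier G. p dvd ord g}"
  have n: "order G = 2 * q * r" using order_eq assms by simp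
  have "\<exists>g\<in>carrier G. 2 dvd ord g \<and> q dvd ord g \<and> r dvd ord g"
  proof (rule ccontr)
    assume none: "\<not> ?thesis"
    let ?b = "\<lambda>p g. of_bool (p dvd ord g) :: nat"
    have "card (?D 2) + card (?D q) + card (?D r) = (\<Sum>g\<in>carrier G. ?b 2 g + ?b q g + ?b r g)"
      using fin by (simp add: sum.distrib Int_def)
    also have "\<dots> = (\<Sum>g\<in>carrier G - {\<one>}. ?b 2 g + ?b q g + ?b r g)"
      using fin gt_2 by (intro sum.mono_neutral_right) auto
    also have "\<dots> \<le> (\<Sum>g\<in>carrier G - {\<one>}. 2)"
      using none by (intro sum_mono) (auto simp: of_bool_def)
    also have "\<dots> = 2 * (2 * q * r - 1)"
      using fin n by (simp add: card_Diff_subset order_def)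
    finally have "q * r + 2 * r * (q - 1) + 2 * q * (r - 1) \<le> 2 * (2 * q * r - 1)"
      using card_2 card_q card_r by simp
    moreover obtain x y where xy: "q = x + 3" "r = y + 3"
      using gt_2 by (metis Suc_eq_plus1 Suc_leI add.commute le_Suc_ex numeral_3_eq_3 numeral_2_eq_2)
    \<comment> \<open>This is \<open>(q - 2) * (r - 2) \<le> 2\<close>, whereas distinct odd primes
      make the product at least 1 * 3.\<close>
    ultimately have "x * y + x + y + 1 \<le> 2" by (simp add: algebra_simps)
    moreover have "x \<noteq> y" "even x" "even y" using xy primes by auto
    ultimately show False by (cases x; cases y) (auto elim!: evenE)
  qed
  then obtain g where g: "g \<in> carrier G" "2 dvd ord g" "q dvd ord g" "r dvd ord g" by blast
  have "coprime q r" using primes primes_coprime by blast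
  then have "q * r dvd ord g" using g by (simp add: divides_mult)
  moreover have "coprime 2 (q * r)" using primes by simp
  ultimately have "2 * (q * r) dvd ord g" using g(2) by (simp add: divides_mult)
  then have "ord g = order G"
    using ord_dvd_group_order[OF g(1)] n by (simp add: dvd_antisym mult.assoc)
  then show ?thesis using iso_integer_mod_group[OF g(1) _ fin] n by simp
qed

end

section \<open>The case of order 4qr\<close>

lemma (in group) commute_of_order_two:
  assumes "subgroup T G" "\<And>x. x \<in> T \<Longrightarrow> x \<otimes> x = \<one>" "x \<in> T" "y \<in> T"
  shows "x \<otimes> y = y \<otimes> x"
proof -
  interpret T: subgroup T G by fact
  have inv_self: "inv z = z" if "z \<in> T" for z using assms(2)[OF that] that by (simp add: inv_equality)
  have "inv (x \<otimes> y) = inv y \<otimes> inv x" using assms(3,4) by (simp add: inv_mult_group)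
  then show ?thesis using inv_self assms(3,4) by simp
qed

locale order_4qr_exponent_group = two_prime_exponent_group G q r 2 for G (structure) and q r
begin

abbreviation "Inv \<equiv> {g \<in> carrier G. ord g = 2}"
abbreviation "C \<equiv> centralizer G (carrier G)"
abbreviation "D p \<equiv> {g \<in> carrier G. p dvd ord g}"

lemma order4: "order G = 2 ^ 2 * (q * r)" using order_eq by simp

lemma not_2_dvd: "\<not> 2 dvd q * r" using primes by simp

lemma Inv_square: "x \<in> Inv \<Longrightarrow> x \<otimes> x = \<one>"
  using pow_eq_id[of x 2] by (simp add: numeral_2_eq_2)

lemma ord_dvd_4_cases:
  assumes "x \<in> carrier G" "x [^] (4::nat) = \<one>"
  shows "x = \<one> \<or> x \<in> Inv"
proof -
  have "ord x dvd 4" using assms by (simp add: pow_eq_id)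
  then have "ord x \<le> 4" by (auto dest: dvd_imp_le)
  moreover have "ord x \<noteq> 4" using not_4_dvd_ord[OF assms(1)] by auto
  moreover have "ord x \<noteq> 3" "ord x \<noteq> 0" using \<open>ord x dvd 4\<close> ord_nonzero[OF fin assms(1)] by auto
  ultimately have "ord x = 1 \<or> ord x = 2" by linarith
  then show ?thesis using ord_eq_1 assms(1) by auto
qed

text \<open>Without elements of order 4, a subgroup of order 4 is a Klein four-group, hence
  abelian.\<close>

lemma card_4_subgroup:
  assumes "subgroup T G" "card T = 4"
  shows "x \<in> T \<Longrightarrow> x \<noteq> \<one> \<Longrightarrow> x \<in> Inv" "x \<in> T \<Longrightarrow> T \<subseteq> C x"
proof -
  interpret T: subgroup T G by fact
  have *: "x = \<one> \<or> x \<in> Inv" if "x \<in> T" for x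
    using subgroup_pow_card_eq_1[OF assms(1) that] assms(2) that by (intro ord_dvd_4_cases) auto
  then show "x \<in> T \<Longrightarrow> x \<noteq> \<one> \<Longrightarrow> x \<in> Inv" by blast
  have "x \<otimes> x = \<one>" if "x \<in> T" for x using *[OF that] Inv_square by auto
  then show "x \<in> T \<Longrightarrow> T \<subseteq> C x"
    using commute_of_order_two[OF assms(1)] T.subset by (auto simp: centralizer_def)
qed

text \<open>The elements whose 2-part lies in the class of \<open>t\<close> form a nonempty set of
  size a multiple of \<open>q * r\<close> inside the \<open>q * r\<close> elements of even order, so
  they are all of these. Any other involution is its own 2-part and therefore lies in the class of
  \<open>t\<close>.\<close>

lemma Inv_conj_class:
  assumes t: "t \<in> Inv"
  shows "Inv = conj_class G (carrier G) t"
proof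
  let ?K = "conj_class G (carrier G) t"
  have tc: "t \<in> carrier G" using t by simp
  show KI: "?K \<subseteq> Inv" using t by (auto simp: conj_class_def ord_conj)
  obtain e where e: "[e = 1] (mod (2 ^ 2))" "[e = 0] (mod (q * r))"
    using hall_exponent[OF two_is_prime_nat not_2_dvd] .
  \<comment> \<open>\<open>e\<close> is odd, so an involution is its own power.\<close>
  have fix_e: "s [^] e = s" if "s \<in> Inv" for s
  proof -
    have "s [^] (2::nat) = \<one>" using that pow_ord_eq_1[of s] by simp
    moreover have "[e = 1] (mod 2)" by (rule cong_dvd_modulus_nat[OF e(1)]) simp
    ultimately show ?thesis using pow_cong[of s 2 e 1] that by simp
  qed
  let ?S = "{g \<in> carrier G. g [^] e \<in> ?K}"
  have "q * r dvd card ?S"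
  proof (rule dvd_card_conj_closed[OF fin two_is_prime_nat order4 not_2_dvd e])
    show "?K \<subseteq> carrier G" using KI by blast
    fix h x assume hx: "h \<in> carrier G" "x \<in> carrier G"
    show "h \<otimes> x \<otimes> inv h \<in> ?K \<longleftrightarrow> x \<in> ?K"
    proof
      assume "x \<in> ?K"
      then show "h \<otimes> x \<otimes> inv h \<in> ?K" using hx tc by (auto simp: conj_class_def conj_conj)
    next
      assume "h \<otimes> x \<otimes> inv h \<in> ?K"
      then obtain k where k: "k \<in> carrier G" "h \<otimes> x \<otimes> inv h = k \<otimes> t \<otimes> inv k"
        by (auto simp: conj_class_def)
      have "x = inv h \<otimes> (h \<otimes> x \<otimes> inv h) \<otimes> inv (inv h)" using hx by (simp add: inv_conj_conj)
      also have "\<dots> = (inv h \<otimes> k) \<otimes> t \<otimes> inv (inv h \<otimes> k)"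
        unfolding k(2) using hx k(1) tc by (intro conj_conj) auto
      finally show "x \<in> ?K" using hx k(1) by (auto simp: conj_class_def)
    qed
  qed
  moreover have sub: "?S \<subseteq> D 2"
  proof
    fix g assume g: "g \<in> ?S"
    then have "2 dvd ord (g [^] e)" using KI by auto
    then show "g \<in> D 2"
      using prime_dvd_ord_pow_hall[OF fin two_is_prime_nat order4 not_2_dvd e(1)] g by simp
  qed
  moreover have "t \<in> ?S"
    using fix_e[OF t] tc by (auto simp: conj_class_def image_iff intro!: bexI[of _ \<one>])
  then have "card ?S > 0" using fin by (auto simp: card_gt_0_iff)
  ultimately have "card ?S \<ge> card (D 2)" unfolding card_2 by (auto dest: dvd_imp_le)
  then have "?S = D 2" using sub fin by (intro card_seteq) auto
  moreover have "Inv \<subseteq> D 2" by auto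
  ultimately have pow: "s [^] e \<in> ?K" if "s \<in> Inv" for s using that by blast
  show "Inv \<subseteq> ?K"
  proof
    fix s assume s: "s \<in> Inv"
    from pow[OF s] show "s \<in> ?K" unfolding fix_e[OF s] .
  qed
qed

text \<open>A Sylow 2-subgroup is abelian of order 4 and so centralizes each of its involutions. The
  class of such an involution therefore has odd size.\<close>

lemma exists_centralizer_card: "\<exists>t \<in> Inv. 4 dvd card (C t)"
proof -
  obtain T where T: "subgroup T G" "card T = 2 ^ 2"
    using sylow_thm[OF two_is_prime_nat is_group order4 fin] by blast
  then have T4: "card T = 4" by simp
  have "\<not> T \<subseteq> {\<one>}" using card_mono[of "{\<one>}" T] T4 by auto
  then obtain t where t: "t \<in> T" "t \<noteq> \<one>" by auto
  then have tI: "t \<in> Inv" using card_4_subgroup(1)[OF T(1) T4] by blast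
  have C: "subgroup (C t) G" using subgroup_centralizer[OF subgroup_self] tI by blast
  have "subgroup T (G\<lparr>carrier := C t\<rparr>)"
    using card_4_subgroup(2)[OF T(1) T4 t(1)] by (intro subgroup_incl[OF T(1) C])
  then have "card T dvd order (G\<lparr>carrier := C t\<rparr>)"
    using group.lagrange[OF subgroup_imp_group[OF C]] by (metis dvd_triv_right)
  then show ?thesis using tI T4 by (auto simp: order_def)
qed

lemma odd_or_Inv:
  assumes "g \<in> carrier G" "g \<noteq> \<one>" "g \<notin> Inv"
  shows "q dvd ord g \<or> r dvd ord g"
proof (rule ccontr)
  assume n: "\<not> ?thesis"
  have "coprime (ord g) q" "coprime (ord g) r"
    using n prime_imp_coprime primes coprime_commute by metis+
  then have "coprime (ord g) (q * r)" by simp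
  moreover have "ord g dvd 4 * (q * r)" using ord_dvd_group_order[OF assms(1)] order4 by simp
  ultimately have "ord g dvd 4" by (metis coprime_dvd_mult_left_iff)
  then have "g [^] (4::nat) = \<one>" using assms(1) by (simp add: pow_eq_id)
  then show False using ord_dvd_4_cases assms by blast
qed

text \<open>The involutions form one class, whose size divides \<open>q * r\<close>. Covering the
  group by the identity, the involutions, \<open>D q\<close> and \<open>D r\<close> gives
  \<open>2 * q + 2 * r \<le> 1 + card Inv\<close>, which excludes the divisors 1, \<open>q\<close>
  and \<open>r\<close>.\<close>

lemma card_Inv: "card Inv = q * r"
proof -
  obtain t where t: "t \<in> Inv" "4 dvd card (C t)" using exists_centralizer_card by blast
  have "card Inv * card (C t) = 4 * (q * r)"
  proof -
    have "t \<in> carrier G" using t(1) by simp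
    from card_conj_class_centralizer[OF subgroup_self this fin] show ?thesis
      using order4 unfolding Inv_conj_class[OF t(1)] by (simp add: order_def)
  qed
  moreover obtain k where "card (C t) = 4 * k" using t(2) by blast
  ultimately have "card Inv * k = q * r" by simp
  then have "card Inv dvd q * r" by (metis dvd_triv_left)
  then have cases: "card Inv = 1 \<or> card Inv = q \<or> card Inv = r \<or> card Inv = q * r"
    by (rule dvd_product_of_primes_trichotomy[OF primes(1,3)])
  have "carrier G \<subseteq> {\<one>} \<union> Inv \<union> D q \<union> D r" using odd_or_Inv by blast
  then have "card (carrier G) \<le> card ({\<one>} \<union> Inv \<union> D q \<union> D r)"
    using fin by (intro card_mono) auto
  also have "\<dots> \<le> 1 + card Inv + card (D q) + card (D r)"
    using card_Un_le[of "{\<one>} \<union> Inv \<union> D q" "D r"] card_Un_le[of "{\<one>} \<union> Inv" "D q"]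
      card_Un_le[of "{\<one>}" Inv] by simp
  finally have le: "4 * (q * r) \<le> 1 + card Inv + 2 * r * (q - 1) + 2 * q * (r - 1)"
    using card_q card_r order4 by (simp add: order_def)
  obtain q' r' where q': "q = Suc q'" "r = Suc r'" using gt_2 by (metis not0_implies_Suc not_less0)
  have "2 * q + 2 * r \<le> 1 + card Inv" using le unfolding q' by (simp add: algebra_simps)
  then show ?thesis using cases gt_2 by auto
qed

lemma D_2_eq_Inv: "D 2 = Inv"
  using card_Inv card_2 fin by (intro card_seteq[symmetric]) auto

lemma Inv_conj:
  assumes "s \<in> Inv" "t \<in> Inv"
  shows "\<exists>h\<in>carrier G. t = h \<otimes> s \<otimes> inv h"
proof -
  have "t \<in> conj_class G (carrier G) s" using Inv_conj_class[OF assms(1)] assms(2) by blast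
  then show ?thesis by (auto simp: conj_class_def)
qed

lemma card_C:
  assumes "t \<in> Inv"
  shows "card (C t) = 4"
proof -
  have "t \<in> carrier G" using assms by simp
  from card_conj_class_centralizer[OF subgroup_self this fin] show ?thesis
    using order4 gt_2 card_Inv unfolding Inv_conj_class[OF assms] by (simp add: order_def)
qed

lemma subgroup_C: "t \<in> Inv \<Longrightarrow> subgroup (C t) G"
  using subgroup_centralizer[OF subgroup_self] by blast

lemma self_in_C: "t \<in> Inv \<Longrightarrow> t \<in> C t" "t \<in> Inv \<Longrightarrow> \<one> \<in> C t"
  by (auto simp: centralizer_def)

lemma C_carrier: "C t \<subseteq> carrier G" by (auto simp: centralizer_def)

text \<open>\<open>C t\<close> is abelian, hence contained in \<open>C x\<close>, and both have
  order 4. Commuting is thus an equivalence relation on the involutions, whose classes are the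
  centralizers without the identity.\<close>

lemma in_C_imp:
  assumes "t \<in> Inv" "x \<in> C t" "x \<noteq> \<one>"
  shows "x \<in> Inv" "C x = C t"
proof -
  show x: "x \<in> Inv" using card_4_subgroup(1)[OF subgroup_C card_C] assms by blast
  have "C t \<subseteq> C x" using card_4_subgroup(2)[OF subgroup_C card_C] assms by blast
  moreover have "finite (C x)" using fin C_carrier finite_subset by blast
  ultimately show "C x = C t" using card_C[OF x] card_C[OF assms(1)]
    by (intro card_seteq[symmetric]) auto
qed

lemma card_Inv_C: "card Inv = 3 * card (C ` Inv)"
proof -
  have "card Inv = (\<Sum>U\<in>C ` Inv. card {x \<in> Inv. C x = U})"
    using sum.group[of Inv "C ` Inv" C "\<lambda>_. 1::nat"] fin by simp
  also have "\<dots> = (\<Sum>U\<in>C ` Inv. 3)"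
  proof (rule sum.cong[OF refl])
    fix U assume "U \<in> C ` Inv"
    then obtain t where t: "t \<in> Inv" "U = C t" by blast
    have "{x \<in> Inv. C x = U} = U - {\<one>}"
    proof (intro subset_antisym subsetI)
      fix x assume "x \<in> {x \<in> Inv. C x = U}"
      then show "x \<in> U - {\<one>}" using self_in_C(1)[of x] by auto
    next
      fix x assume "x \<in> U - {\<one>}"
      then show "x \<in> {x \<in> Inv. C x = U}" using in_C_imp[OF t(1), of x] t(2) by blast
    qed
    moreover have "\<one> \<in> U" using self_in_C(2)[OF t(1)] t(2) by simp
    ultimately show "card {x \<in> Inv. C x = U} = 3" using card_C[OF t(1)] t(2) by simp
  qed
  finally show ?thesis by simp
qed

lemma three_cases: "q = 3 \<or> r = 3"
proof -
  have "3 dvd q * r" using card_Inv_C card_Inv by (metis dvd_triv_left)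
  moreover have "prime (3::nat)" by simp
  ultimately have "3 dvd q \<or> 3 dvd r" by (simp add: prime_dvd_mult_iff)
  then show ?thesis using primes primes_dvd_imp_eq[OF \<open>prime 3\<close>] by metis
qed

text \<open>Outside the identity and the \<open>3 * r\<close> involutions lie
  \<open>9 * r - 1\<close> elements, all in \<open>D 3\<close> or \<open>D r\<close>, while these
  two sets have \<open>4 * r + 6 * (r - 1)\<close> elements together. The overlap thus has size
  \<open>r - 5\<close>. If it were nonempty, some element would have order \<open>3 * r\<close>, and
  the \<open>2 * (r - 1)\<close> generators of its cyclic group would not fit.\<close>

lemma r_eq_5:
  assumes q3: "q = 3"
  shows "r = 5"
proof -
  have co: "card (carrier G) = 12 * r" using order4 q3 by (simp add: order_def)
  have finD: "finite (D p)" for p using fin by simp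
  have un: "carrier G = insert \<one> Inv \<union> (D 3 \<union> D r)" using odd_or_Inv q3 by auto
  have "\<not> 3 dvd (2::nat)" "\<not> r dvd 2" "\<not> r dvd 1" using not_dvd q3 primes by auto
  then have "insert \<one> Inv \<inter> (D 3 \<union> D r) = {}" by auto
  then have "12 * r = card (insert \<one> Inv) + card (D 3 \<union> D r)"
    using un fin co by (subst card_Un_disjoint[symmetric]) auto
  also have "card (insert \<one> Inv) = 1 + 3 * r" using card_Inv fin q3 by simp
  finally have c1: "12 * r = 1 + 3 * r + card (D 3 \<union> D r)" .
  have c2: "card (D 3 \<union> D r) + card (D 3 \<inter> D r) = 4 * r + 6 * (r - 1)"
    using card_Un_Int[OF finD finD, of 3 r] card_q card_r q3 by simp
  have "D 3 \<inter> D r = {}"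
  proof (rule ccontr)
    assume "D 3 \<inter> D r \<noteq> {}"
    then obtain g where g: "g \<in> carrier G" "3 dvd ord g" "r dvd ord g" by blast
    have cop: "coprime 3 r" using primes q3 primes_coprime by blast
    then have d: "3 * r dvd ord g" using g by (simp add: divides_mult)
    then obtain k where k: "ord g = 3 * r * k" by blast
    have k0: "k \<noteq> 0" using k ord_nonzero[OF fin g(1)] by auto
    define z where "z = g [^] k"
    have zc: "z \<in> carrier G" using g by (simp add: z_def)
    have oz: "ord z = 3 * r" unfolding z_def using ord_pow[OF g(1), of k] k k0 by simp
    have "(\<lambda>j. z [^] j) ` totatives (3 * r) \<subseteq> D 3 \<inter> D r"
    proof safe
      fix j assume j: "j \<in> totatives (3 * r)"
      then have "j \<noteq> 0" "gcd (ord z) j = 1" unfolding oz totatives_def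
        by (auto simp: coprime_iff_gcd_eq_1 gcd.commute)
      then have oj: "ord (z [^] j) = 3 * r" using ord_pow_gen[OF zc, of j] oz by simp
      show "z [^] j \<in> carrier G" "z [^] j \<in> carrier G" using zc by auto
      show "3 dvd ord (z [^] j)" "r dvd ord (z [^] j)" unfolding oj by simp_all
    qed
    then have "card ((\<lambda>j. z [^] j) ` totatives (3 * r)) \<le> card (D 3 \<inter> D r)"
      using fin by (intro card_mono) auto
    also have "card ((\<lambda>j. z [^] j) ` totatives (3 * r)) = card (totatives (3 * r))"
    proof (rule card_image, rule inj_on_subset[OF ord_inj'[OF zc]])
      show "totatives (3 * r) \<subseteq> {1..ord z}" unfolding oz totatives_def by auto
    qed
    also have "card (totatives (3 * r)) = 2 * (r - 1)"
      using totient_mult_coprime[OF cop] totient_prime[OF primes(3)] totient_prime[of 3]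
      by (simp add: totient_def)
    finally show False using c1 c2 gt_2 by simp
  qed
  then have "card (D 3 \<inter> D r) = 0" by (simp only: card.empty)
  then show ?thesis using c1 c2 gt_2 by simp
qed

end

section \<open>The action on the centralizers of the involutions\<close>

locale order_60_group = order_4qr_exponent_group G 3 5 for G (structure)
begin

definition act :: "'a \<Rightarrow> 'a set \<Rightarrow> 'a set" where
  "act g U = (\<lambda>x. g \<otimes> x \<otimes> inv g) ` U"

lemma act_C:
  assumes "g \<in> carrier G" "t \<in> carrier G"
  shows "act g (C t) = C (g \<otimes> t \<otimes> inv g)"
proof -
  have *: "act h (C s) \<subseteq> C (h \<otimes> s \<otimes> inv h)" if h: "h \<in> carrier G" and s: "s \<in> carrier G" for h s
  proof
    fix y assume "y \<in> act h (C s)"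
    then obtain x where x: "x \<in> carrier G" "x \<otimes> s = s \<otimes> x" "y = h \<otimes> x \<otimes> inv h"
      by (auto simp: act_def centralizer_def)
    have m: "(h \<otimes> u \<otimes> inv h) \<otimes> (h \<otimes> w \<otimes> inv h) = h \<otimes> (u \<otimes> w) \<otimes> inv h"
      if "u \<in> carrier G" "w \<in> carrier G" for u w
    proof -
      have "(h \<otimes> u \<otimes> inv h) \<otimes> (h \<otimes> w \<otimes> inv h) = h \<otimes> u \<otimes> (inv h \<otimes> (h \<otimes> w \<otimes> inv h) \<otimes> h) \<otimes> inv h"
        using h that by (simp add: m_assoc)
      then show ?thesis using h that by (simp add: inv_conj_conj) (simp add: m_assoc)
    qed
    show "y \<in> C (h \<otimes> s \<otimes> inv h)"
      unfolding centralizer_def using x m[OF x(1) s] m[OF s x(1)] h by simp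
  qed
  show ?thesis
  proof
    let ?s = "g \<otimes> t \<otimes> inv g"
    show "C ?s \<subseteq> act g (C t)"
    proof
      fix y assume y: "y \<in> C ?s"
      then have yc: "y \<in> carrier G" using C_carrier by blast
      have "inv g \<otimes> y \<otimes> g \<in> act (inv g) (C ?s)" using y assms by (auto simp: act_def)
      then have "inv g \<otimes> y \<otimes> g \<in> C t"
        using *[of "inv g" ?s] assms by (auto simp: inv_conj_conj)
      moreover have "y = g \<otimes> (inv g \<otimes> y \<otimes> g) \<otimes> inv g"
        using inv_conj_conj[of "inv g" y] assms yc by simp
      ultimately show "y \<in> act g (C t)" unfolding act_def by blast
    qed
  qed (rule *[OF assms])
qed

abbreviation "Fam \<equiv> C ` Inv"

lemma conj_Inv: "g \<in> carrier G \<Longrightarrow> t \<in> Inv \<Longrightarrow> g \<otimes> t \<otimes> inv g \<in> Inv"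
  by (simp add: ord_conj)

lemma act_Fam: "g \<in> carrier G \<Longrightarrow> U \<in> Fam \<Longrightarrow> act g U \<in> Fam"
  using act_C conj_Inv by (smt (verit) image_iff mem_Collect_eq)

lemma act_mult:
  assumes "g \<in> carrier G" "h \<in> carrier G" "U \<in> Fam"
  shows "act (g \<otimes> h) U = act g (act h U)"
proof -
  have "U \<subseteq> carrier G" using assms(3) C_carrier by blast
  then show ?thesis unfolding act_def image_image using assms(1,2)
    by (intro image_cong refl) (auto simp: conj_conj)
qed

lemma act_one: "U \<in> Fam \<Longrightarrow> act \<one> U = U"
proof -
  assume "U \<in> Fam"
  then have "U \<subseteq> carrier G" using C_carrier by blast
  then have "(\<lambda>x. \<one> \<otimes> x \<otimes> inv \<one>) ` U = (\<lambda>x. x) ` U" by (intro image_cong refl) auto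
  then show "act \<one> U = U" unfolding act_def by simp
qed

lemma card_Fam: "card Fam = 5"
  using card_Inv_C card_Inv by simp

lemma Fam_finite: "finite Fam" using fin by simp

lemma exists_other:
  assumes "t \<in> Inv"
  shows "\<exists>s\<in>Inv. C s \<noteq> C t"
proof (rule ccontr)
  assume "\<not> ?thesis"
  then have "Fam \<subseteq> {C t}" by blast
  then have "card Fam \<le> 1" using card_mono[of "{C t}" Fam] by simp
  then show False using card_Fam by simp
qed

lemma C_Int:
  assumes "s \<in> Inv" "t \<in> Inv" "C s \<noteq> C t" "x \<in> C s" "x \<in> C t"
  shows "x = \<one>"
  using in_C_imp(2)[OF assms(1,4)] in_C_imp(2)[OF assms(2,5)] assms(3) by blast

text \<open>As \<open>t\<close> is its own inverse, this is the commutator of \<open>g\<close> and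
  \<open>t\<close>, a product of two elements of the normalized subgroup \<open>C t\<close>.\<close>

lemma commutator_in_C:
  assumes "g \<in> carrier G" "t \<in> Inv" "act g (C t) = C t"
  shows "g \<otimes> t \<otimes> inv g \<otimes> t \<in> C t"
proof -
  interpret subgroup "C t" G by (rule subgroup_C[OF assms(2)])
  have "g \<otimes> t \<otimes> inv g \<in> act g (C t)" using self_in_C(1)[OF assms(2)] by (auto simp: act_def)
  then have "g \<otimes> t \<otimes> inv g \<in> C t" by (simp only: assms(3))
  then show ?thesis by (rule m_closed[OF _ self_in_C(1)[OF assms(2)]])
qed

lemma Inv_inv: "t \<in> Inv \<Longrightarrow> inv t = t"
  using Inv_square[of t] by (intro inv_equality) auto

text \<open>Involutions are conjugate, so if one normalized all the centralizers, every involution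
  would. For \<open>C s \<noteq> C u\<close> the commutator of \<open>s\<close> and \<open>u\<close>
  would then lie in both, hence be trivial, and \<open>s\<close> would commute with
  \<open>u\<close>.\<close>

lemma fixing_not_Inv:
  assumes "u \<in> Inv"
  shows "\<exists>U\<in>Fam. act u U \<noteq> U"
proof (rule ccontr)
  assume "\<not> ?thesis"
  then have fu: "act u U = U" if "U \<in> Fam" for U using that by blast
  have f: "act s U = U" if s: "s \<in> Inv" and U: "U \<in> Fam" for s U
  proof -
    obtain h where h: "h \<in> carrier G" "s = h \<otimes> u \<otimes> inv h" using Inv_conj[OF assms s] by blast
    have uc: "u \<in> carrier G" using assms by simp
    have V: "act (inv h) U \<in> Fam" using act_Fam[OF _ U] h(1) by blast
    have "act s U = act h (act u (act (inv h) U))"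
      unfolding h(2) using act_mult[OF _ _ U, of "h \<otimes> u" "inv h"] act_mult[OF h(1) uc V] h(1) uc by simp
    also have "\<dots> = act (h \<otimes> inv h) U" using fu[OF V] act_mult[OF h(1) _ U, of "inv h"] h(1) by simp
    finally show ?thesis using act_one[OF U] h(1) by simp
  qed
  obtain s where s: "s \<in> Inv" "C s \<noteq> C u" using exists_other[OF assms] by blast
  have sc: "s \<in> carrier G" "u \<in> carrier G" using s assms by auto
  have c1: "s \<otimes> u \<otimes> inv s \<otimes> u \<in> C u" using assms f[OF s(1)] sc by (intro commutator_in_C) auto
  have c2: "u \<otimes> s \<otimes> inv u \<otimes> s \<in> C s" using s f[OF assms] sc by (intro commutator_in_C) auto
  interpret S: subgroup "C s" G by (rule subgroup_C[OF s(1)])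
  \<comment> \<open>Exchanging the two entries inverts a commutator, which moves it from
    \<open>C s\<close> back to the form known to lie in \<open>C u\<close>.\<close>
  have "inv (u \<otimes> s \<otimes> inv u \<otimes> s) = s \<otimes> u \<otimes> inv s \<otimes> u"
    using sc Inv_inv[OF s(1)] Inv_inv[OF assms] by (simp add: inv_mult_group m_assoc)
  then have "s \<otimes> u \<otimes> inv s \<otimes> u \<in> C s" using S.m_inv_closed[OF c2] by simp
  then have "s \<otimes> u \<otimes> inv s \<otimes> u = \<one>" using C_Int[OF s(1) assms s(2)] c1 by blast
  then have "s \<otimes> u \<otimes> inv s = inv u" using sc by (intro inv_equality[symmetric]) auto
  then have "s \<otimes> u = u \<otimes> s"
    using conj_eq_iff[of s u u] sc Inv_inv[OF assms] by simp
  then have "s \<in> C u" unfolding centralizer_def using sc by blast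
  moreover have "s \<noteq> \<one>" using s(1) by auto
  ultimately show False using in_C_imp(2)[OF assms, of s] s(2) by simp
qed

text \<open>For an involution \<open>t\<close> the commutator of \<open>g\<close> and
  \<open>t\<close> also acts trivially, and it lies in \<open>C t\<close>; by
  \<open>fixing_not_Inv\<close> it is not an involution, so it is trivial. Hence \<open>g\<close>
  lies in every centralizer, and two different ones meet only in the identity.\<close>

lemma act_faithful:
  assumes g: "g \<in> carrier G" and fix_g: "\<And>U. U \<in> Fam \<Longrightarrow> act g U = U"
  shows "g = \<one>"
proof -
  have fix_inv: "act (inv g) U = U" if "U \<in> Fam" for U
    using act_mult[OF _ g that, of "inv g"] act_one[OF that] fix_g[OF that] g by simp
  have comm: "g \<in> C t" if t: "t \<in> Inv" for t
  proof -
    have tc: "t \<in> carrier G" using t by simp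
    let ?u = "g \<otimes> t \<otimes> inv g \<otimes> t"
    have uC: "?u \<in> C t" using t fix_g g by (intro commutator_in_C) auto
    have "act ?u U = U" if U: "U \<in> Fam" for U
    proof -
      have V: "act t U \<in> Fam" using act_Fam[OF tc U] .
      have "act ?u U = act (g \<otimes> t \<otimes> inv g) (act t U)"
        using act_mult[OF _ tc U, of "g \<otimes> t \<otimes> inv g"] g tc by simp
      also have "\<dots> = act (g \<otimes> t) (act (inv g) (act t U))"
        using act_mult[OF _ _ V, of "g \<otimes> t" "inv g"] g tc by simp
      also have "\<dots> = act g (act t (act t U))"
        using act_mult[OF g tc V] fix_inv[OF V] by simp
      also have "\<dots> = act g (act (t \<otimes> t) U)" using act_mult[OF tc tc U] by simp
      also have "\<dots> = U" using Inv_square[OF t] act_one[OF U] fix_g[OF U] by simp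
      finally show ?thesis .
    qed
    then have "?u \<notin> Inv" using fixing_not_Inv by blast
    then have "?u = \<one>" using in_C_imp(1)[OF t uC] by blast
    then have "g \<otimes> t \<otimes> inv g = inv t" using g tc by (intro inv_equality[symmetric]) auto
    then have "g \<otimes> t = t \<otimes> g" using conj_eq_iff[of g t t] g tc Inv_inv[OF t] by simp
    then show ?thesis using g by (simp add: centralizer_def)
  qed
  have "Inv \<noteq> {}" using card_Inv by (metis card.empty mult_eq_0_iff zero_neq_numeral)
  then obtain t where t: "t \<in> Inv" by blast
  obtain s where "s \<in> Inv" "C s \<noteq> C t" using exists_other[OF t] by blast
  then show ?thesis using C_Int[OF _ t] comm t by blast
qed

theorem iso_alt_group: "G \<cong> alt_group 5"
proof -
  obtain b where b: "bij_betw b {1..5::nat} Fam"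
    using finite_same_card_bij[of "{1..5::nat}" Fam] Fam_finite card_Fam by auto
  define b' where "b' = inv_into {1..5::nat} b"
  have b': "bij_betw b' Fam {1..5}" unfolding b'_def by (rule bij_betw_inv_into[OF b])
  have bb': "b (b' U) = U" if "U \<in> Fam" for U
    unfolding b'_def using bij_betw_inv_into_right[OF b that] .
  have b'b: "b' (b i) = i" if "i \<in> {1..5}" for i
    unfolding b'_def using bij_betw_inv_into_left[OF b that] .
  have bF: "b i \<in> Fam" if "i \<in> {1..5}" for i using bij_betwE[OF b] that by blast
  have b'F: "b' U \<in> {1..5}" if "U \<in> Fam" for U using bij_betwE[OF b'] that by blast
  \<comment> \<open>The action carried over to the labels 1 to 5; elsewhere it is the identity, as
    \<open>permutes\<close> demands.\<close>
  define \<psi> where "\<psi> g i = (if i \<in> {1..5} then b' (act g (b i)) else i)" for g i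
  have \<psi>_in: "\<psi> g i \<in> {1..5}" if "g \<in> carrier G" "i \<in> {1..5}" for g i
    using b'F act_Fam[OF that(1) bF[OF that(2)]] that by (simp add: \<psi>_def)
  have \<psi>_mult: "\<psi> (g \<otimes> h) = \<psi> g \<circ> \<psi> h" if gh: "g \<in> carrier G" "h \<in> carrier G" for g h
  proof
    fix i show "\<psi> (g \<otimes> h) i = (\<psi> g \<circ> \<psi> h) i"
    proof (cases "i \<in> {1..5}")
      case True
      have F: "act h (b i) \<in> Fam" by (rule act_Fam[OF gh(2) bF[OF True]])
      have "b (\<psi> h i) = act h (b i)" using bb'[OF F] True by (simp only: \<psi>_def if_True)
      then show ?thesis using True \<psi>_in[OF gh(2) True] act_mult[OF gh bF[OF True]]
        by (simp only: \<psi>_def[of g] \<psi>_def[of "g \<otimes> h"] if_True o_def)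
    next
      case False
      then show ?thesis unfolding \<psi>_def o_def by (simp only: if_False)
    qed
  qed
  have \<psi>_one: "\<psi> \<one> = id"
    using act_one bF b'b by (auto simp: \<psi>_def fun_eq_iff simp del: atLeastAtMost_iff)
  have \<psi>_perm: "\<psi> g permutes {1..5}" if g: "g \<in> carrier G" for g
  proof (rule bij_imp_permutes)
    have "\<psi> g \<circ> \<psi> (inv g) = id" "\<psi> (inv g) \<circ> \<psi> g = id"
      using \<psi>_mult[of g "inv g"] \<psi>_mult[of "inv g" g] \<psi>_one g by simp_all
    then show "bij_betw (\<psi> g) {1..5} {1..5}"
      using \<psi>_in[OF g] \<psi>_in[of "inv g"] g
      by (intro bij_betw_byWitness[where f' = "\<psi> (inv g)"]) (auto simp: o_def id_def fun_eq_iff simp del: atLeastAtMost_iff)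
    show "\<psi> g x = x" if "x \<notin> {1..5}" for x unfolding \<psi>_def using that by (simp only: if_False)
  qed
  have perm: "permutation (\<psi> g)" if "g \<in> carrier G" for g
    using \<psi>_perm[OF that] permutation_permutes by blast
  have \<psi>_kernel: "g = \<one>" if g: "g \<in> carrier G" and "\<psi> g = id" for g
  proof (rule act_faithful[OF g])
    fix U assume U: "U \<in> Fam"
    have "b' (act g U) = b' U"
      using fun_cong[OF \<open>\<psi> g = id\<close>, of "b' U"] b'F[OF U] bb'[OF U] by (simp only: \<psi>_def if_True id_apply)
    then show "act g U = U" 
      by (rule inj_onD[OF bij_betw_imp_inj_on[OF b'] _ act_Fam[OF g U] U])
  qed
  have inj: "inj_on \<psi> (carrier G)"
  proof (rule inj_onI)
    fix g h assume gh: "g \<in> carrier G" "h \<in> carrier G" "\<psi> g = \<psi> h"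
    have "\<psi> (inv h \<otimes> g) = \<psi> (inv h \<otimes> h)"
      using \<psi>_mult[of "inv h" g] \<psi>_mult[of "inv h" h] gh by (simp del: l_inv)
    then have "inv h \<otimes> g = \<one>" using \<psi>_kernel gh \<psi>_one by simp
    then show "g = h" using gh by (metis inv_closed inv_equality inv_inv m_closed)
  qed
  \<comment> \<open>An element of odd order is a square: with \<open>2 * k = ord g + 1\<close> it is
    the square of \<open>g [^] k\<close>, and squares of permutations are even.\<close>
  have even_odd: "evenperm (\<psi> g)" if g: "g \<in> carrier G - Inv" for g
  proof -
    have gc: "g \<in> carrier G" using g by simp
    have "odd (ord g)" using g D_2_eq_Inv by blast
    then obtain k where k: "ord g + 1 = k + k" by (metis evenE even_plus_one_iff mult_2)
    have "g = g [^] k \<otimes> g [^] k"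
      using nat_pow_mult[OF gc, of k k] pow_ord_eq_1[OF gc] gc unfolding k[symmetric] by simp
    then have "\<psi> g = \<psi> (g [^] k) \<circ> \<psi> (g [^] k)" using \<psi>_mult[of "g [^] k" "g [^] k"] gc by simp
    then show ?thesis using evenperm_comp[OF perm perm, of "g [^] k" "g [^] k"] gc by simp
  qed
  have n60: "card (carrier G) = 60" using order4 by (simp add: order_def)
  \<comment> \<open>Multiplication by an element acting oddly would send the 45 elements outside
    \<open>Inv\<close> injectively to elements acting oddly, which lie among the 15
    involutions.\<close>
  have even_all: "evenperm (\<psi> g)" if g: "g \<in> carrier G" for g
  proof (rule ccontr)
    assume odd_g: "\<not> evenperm (\<psi> g)"
    let ?O = "carrier G - Inv"
    have O: "card ?O = 45" using card_Inv fin n60 by (subst card_Diff_subset) auto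
    have "(\<lambda>x. g \<otimes> x) ` ?O \<subseteq> Inv"
    proof
      fix y assume "y \<in> (\<lambda>x. g \<otimes> x) ` ?O"
      then obtain x where x: "x \<in> ?O" "y = g \<otimes> x" by blast
      have "\<psi> y = \<psi> g \<circ> \<psi> x" using \<psi>_mult[OF g] x by simp
      then have "\<not> evenperm (\<psi> y)"
        using evenperm_comp[OF perm[OF g] perm, of x] even_odd[OF x(1)] odd_g x(1) by simp
      then show "y \<in> Inv" using even_odd[of y] x g by blast
    qed
    then have "card ((\<lambda>x. g \<otimes> x) ` ?O) \<le> card Inv" using fin by (intro card_mono) auto
    moreover have "card ((\<lambda>x. g \<otimes> x) ` ?O) = 45"
      using O g by (subst card_image) (auto simp: inj_on_def)
    ultimately show False using card_Inv by simp
  qed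
  have sub: "\<psi> ` carrier G \<subseteq> carrier (alt_group 5)"
    using even_all \<psi>_perm by (auto simp: alt_group_carrier)
  have c60: "card (carrier (alt_group 5)) = 60"
    using alt_group_card_carrier[of 5] by (simp add: fact_numeral)
  then have "finite (carrier (alt_group 5))" by (metis card.infinite zero_neq_numeral)
  then have "\<psi> ` carrier G = carrier (alt_group 5)"
    using sub card_image[OF inj] n60 c60 by (intro card_subset_eq) auto
  then have "\<psi> \<in> iso G (alt_group 5)"
    using inj \<psi>_mult sub by (auto simp: iso_def bij_betw_def hom_def alt_group_mult)
  then show ?thesis by (auto simp: is_iso_def)
qed

end

section \<open>The group PSL(2,5)\<close>

abbreviation SL25 :: "(5 ^ 2 ^ 2) monoid" where "SL25 \<equiv> SL"

lemma five_cases: "(x::5) = 0 \<or> x = 1 \<or> x = 2 \<or> x = 3 \<or> x = 4"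
proof (induct x rule: bit1_induct)
  case (of_int z)
  then have "z = 0 \<or> z = 1 \<or> z = 2 \<or> z = 3 \<or> z = 4"
    by simp presburger
  then show ?case by (elim disjE) simp_all
qed

lemma UNIV_5: "(UNIV :: 5 set) = {0, 1, 2, 3, 4}"
  using five_cases by auto

lemma sum_UNIV_5: "(\<Sum>x\<in>UNIV. f (x::5)) = f 0 + f 1 + f 2 + f 3 + (f 4 :: nat)"
  unfolding UNIV_5 by (simp add: add.assoc)

section \<open>Counting matrices of determinant 1 over the field with five elements by trace\<close>

definition mat2 :: "'a \<Rightarrow> 'a \<Rightarrow> 'a \<Rightarrow> 'a \<Rightarrow> 'a ^ 2 ^ 2" where
  "mat2 a b c d = (\<chi> i j. if i = 1 then (if j = 1 then a else b) else (if j = 1 then c else d))"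

lemma mat2_nth [simp]:
  "mat2 a b c d $ 1 $ 1 = a" "mat2 a b c d $ 1 $ 2 = b"
  "mat2 a b c d $ 2 $ 1 = c" "mat2 a b c d $ 2 $ 2 = d"
  by (simp_all add: mat2_def)

lemma det_mat2: "det (mat2 a b c d :: 'a::comm_ring_1 ^ 2 ^ 2) = a * d - b * c"
  by (simp add: det_2)

text \<open>The trace fixes the last diagonal entry, so three free entries remain; the count becomes
  an explicit sum that can be evaluated.\<close>

lemma card_SL25_trace:
  "card {A \<in> carrier SL25. A$1$1 + A$2$2 = t}
    = (\<Sum>a\<in>UNIV. \<Sum>b\<in>UNIV. \<Sum>c\<in>UNIV. of_bool (a * (t - a) - b * c = 1))"
proof -
  let ?S = "{A \<in> carrier SL25. A$1$1 + A$2$2 = t}"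
  let ?T = "{(a, b, c). a * (t - a) - b * c = 1}"
  have "bij_betw (\<lambda>(a, b, c). mat2 a b c (t - a)) ?T ?S"
  proof (rule bij_betw_byWitness[where f' = "\<lambda>A. (A$1$1, A$1$2, A$2$1)"])
    show "\<forall>A\<in>?S. (\<lambda>(a, b, c). mat2 a b c (t - a)) (A$1$1, A$1$2, A$2$1) = A"
      by (auto simp: vec_eq_iff forall_2)
  qed (auto simp: SL_def det_2 algebra_simps)
  then have "card ?S = card ?T" by (rule bij_betw_same_card[symmetric])
  also have "\<dots> = (\<Sum>x\<in>UNIV. of_bool (x \<in> ?T))" by simp
  also have "\<dots> = (\<Sum>a\<in>UNIV. \<Sum>b\<in>UNIV. \<Sum>c\<in>UNIV. of_bool ((a, b, c) \<in> ?T))"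
    unfolding UNIV_Times_UNIV[symmetric] sum.cartesian_product by (simp add: case_prod_unfold)
  finally show ?thesis by simp
qed

lemma card_SL25_trace_values:
  "card {A \<in> carrier SL25. A$1$1 + A$2$2 = 0} = 30"
  "card {A \<in> carrier SL25. A$1$1 + A$2$2 = 1} = 20"
  "card {A \<in> carrier SL25. A$1$1 + A$2$2 = 2} = 25"
  "card {A \<in> carrier SL25. A$1$1 + A$2$2 = 3} = 25"
  "card {A \<in> carrier SL25. A$1$1 + A$2$2 = 4} = 20"
  unfolding card_SL25_trace sum_UNIV_5 by simp_all

lemma centre_SL25: "centre SL25 = {mat2 1 0 0 1, mat2 (-1) 0 0 (-1)}"
proof (intro subset_antisym subsetI)
  fix A assume "A \<in> centre SL25"
  then have A: "det A = 1" and comm: "\<And>B. det B = 1 \<Longrightarrow> A ** B = B ** A"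
    by (auto simp: centre_def SL_def)
  \<comment> \<open>Commuting with the two elementary transvections already forces a matrix to be
    scalar.\<close>
  have c1: "A ** mat2 1 1 0 1 = mat2 1 1 0 1 ** A" by (rule comm) (simp add: det_mat2)
  have c2: "A ** mat2 1 0 1 1 = mat2 1 0 1 1 ** A" by (rule comm) (simp add: det_mat2)
  have "A$1$2 = 0" "A$2$1 = 0" "A$2$2 = A$1$1"
    using c1 c2 by (auto simp: vec_eq_iff forall_2 matrix_matrix_mult_def sum_2)
  moreover from this have "A$1$1 * A$1$1 = 1" using A by (simp add: det_2)
  then have "A$1$1 = 1 \<or> A$1$1 = -1" using five_cases[of "A$1$1"] by (elim disjE) simp_all
  ultimately show "A \<in> {mat2 1 0 0 1, mat2 (-1) 0 0 (-1)}"
    by (auto simp: vec_eq_iff forall_2)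
next
  fix A :: "5 ^ 2 ^ 2" assume "A \<in> {mat2 1 0 0 1, mat2 (-1) 0 0 (-1)}"
  then show "A \<in> centre SL25"
    by (auto simp: centre_def SL_def det_mat2 det_2 vec_eq_iff forall_2 matrix_matrix_mult_def sum_2)
qed

text \<open>The matrix u A + w 1. All powers of \<open>A\<close> have this form, so each is recorded
  by two scalars.\<close>

definition lin :: "'a::comm_ring_1 \<Rightarrow> 'a \<Rightarrow> 'a ^ 2 ^ 2 \<Rightarrow> 'a ^ 2 ^ 2" where
  "lin u w A = mat2 (u * A$1$1 + w) (u * A$1$2) (u * A$2$1) (u * A$2$2 + w)"

text \<open>Cayley--Hamilton: \<open>A\<^sup>2 = t A - 1\<close> for a matrix of determinant 1 and trace \<open>t\<close>.\<close>

lemma lin_mult: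
  assumes "det A = 1" "A$1$1 + A$2$2 = t"
  shows "lin u w A ** A = lin (t * u + w) (- u) A"
proof -
  have "A$1$1 * A$2$2 = 1 + A$1$2 * A$2$1" using assms(1) by (simp add: det_2 algebra_simps)
  then show ?thesis unfolding assms(2)[symmetric]
    by (simp add: vec_eq_iff forall_2 matrix_matrix_mult_def sum_2 lin_def algebra_simps)
qed


section \<open>Element orders in PSL(2,5)\<close>

interpretation SL25: group SL25 by (rule group_SL)

interpretation centre_SL25: normal "centre SL25" SL25
  by (rule normal_centre[OF group_SL])

interpretation PSL25: group PSL_2_5 by (rule group_PSL_2_5)

lemma finite_SL25: "finite (carrier SL25)"
proof -
  have "card (UNIV :: (5 ^ 2 ^ 2) set) > 0" by simp
  then have "finite (UNIV :: (5 ^ 2 ^ 2) set)" by (rule card_ge_0_finite)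
  then show ?thesis by (rule finite_subset[OF subset_UNIV])
qed

lemma lin_in_centre: "u = 0 \<Longrightarrow> w = 1 \<or> w = -1 \<Longrightarrow> lin u w A \<in> centre SL25"
  by (auto simp: centre_SL25 lin_def)

lemma SL25_pow_Suc_lin:
  assumes "A \<in> carrier SL25" "A$1$1 + A$2$2 = t" "A [^]\<^bsub>SL25\<^esub> (n::nat) = lin u w A"
  shows "A [^]\<^bsub>SL25\<^esub> Suc n = lin (t * u + w) (- u) A"
  using lin_mult[OF _ assms(2), of u w] assms(1,3) by (simp add: SL_def)

lemma SL25_pow_0_lin: "A [^]\<^bsub>SL25\<^esub> (0::nat) = lin 0 1 A"
  by (simp add: SL_def lin_def vec_eq_iff forall_2 mat_def)

text \<open>The coefficients of \<open>A\<close> obey the recursion of Chebyshev polynomials of the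
  second kind: each is \<open>t\<close> times the previous one minus the one before. The constant
  term is minus the previous coefficient.\<close>

lemma SL25_pow_lin:
  assumes "A \<in> carrier SL25" "A$1$1 + A$2$2 = t"
  shows "A [^]\<^bsub>SL25\<^esub> (2::nat) = lin t (-1) A"
    "A [^]\<^bsub>SL25\<^esub> (3::nat) = lin (t * t - 1) (- t) A"
    "A [^]\<^bsub>SL25\<^esub> (5::nat) = lin (t * (t * (t * t - 1) - t) - (t * t - 1)) (t - t * (t * t - 1)) A"
proof -
  note step = SL25_pow_Suc_lin[OF assms]
  have p1: "A [^]\<^bsub>SL25\<^esub> Suc 0 = lin 1 0 A" using step[OF SL25_pow_0_lin] by simp
  have p2: "A [^]\<^bsub>SL25\<^esub> Suc (Suc 0) = lin t (-1) A" using step[OF p1] by simp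
  have p3: "A [^]\<^bsub>SL25\<^esub> Suc (Suc (Suc 0)) = lin (t * t - 1) (- t) A" using step[OF p2] by simp
  note p4 = step[OF p3]
  note p5 = step[OF p4]
  show "A [^]\<^bsub>SL25\<^esub> (2::nat) = lin t (-1) A" using p2 by (simp only: numeral_2_eq_2)
  show "A [^]\<^bsub>SL25\<^esub> (3::nat) = lin (t * t - 1) (- t) A" using p3 by (simp only: numeral_3_eq_3)
  have five: "(5::nat) = Suc (Suc (Suc (Suc (Suc 0))))" by simp
  show "A [^]\<^bsub>SL25\<^esub> (5::nat) = lin (t * (t * (t * t - 1) - t) - (t * t - 1)) (t - t * (t * t - 1)) A"
    unfolding five p5 by (simp only: minus_diff_eq diff_conv_add_uminus minus_add_distrib add.commute minus_minus)
qed

text \<open>A prime exponent at which the coefficient of \<open>A\<close> in the power vanishes: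
  \<open>t\<close> vanishes at 0, \<open>t * t - 1\<close> at 1 and 4, and the coefficient for the
  fifth power at the remaining values 2 and 3.\<close>

definition trace_order :: "5 \<Rightarrow> nat" where
  "trace_order t = (if t = 0 then 2 else if t = 1 \<or> t = 4 then 3 else 5)"

lemma prime_trace_order: "prime (trace_order t)"
  by (simp add: trace_order_def)

lemma SL25_pow_trace_order:
  assumes "A \<in> carrier SL25"
  shows "A [^]\<^bsub>SL25\<^esub> trace_order (A$1$1 + A$2$2) \<in> centre SL25"
proof -
  note p = SL25_pow_lin[OF assms refl]
  consider "A$1$1 + A$2$2 = 0" | "A$1$1 + A$2$2 = 1" | "A$1$1 + A$2$2 = 2"
    | "A$1$1 + A$2$2 = 3" | "A$1$1 + A$2$2 = 4"
    using five_cases by blast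
  then show ?thesis
    by cases (simp_all add: trace_order_def p lin_in_centre)
qed

text \<open>The order divides \<open>trace_order\<close>, which is prime, so it can only be smaller
  for the trivial coset. The central matrices need their own case because they have trace 2 or 3 as
  well.\<close>

lemma ord_PSL25:
  assumes A: "A \<in> carrier SL25"
  shows "PSL25.ord (centre SL25 #>\<^bsub>SL25\<^esub> A)
    = (if A \<in> centre SL25 then 1 else trace_order (A$1$1 + A$2$2))"
proof -
  let ?X = "centre SL25 #>\<^bsub>SL25\<^esub> A" and ?p = "trace_order (A$1$1 + A$2$2)"
  have X: "?X \<in> carrier PSL_2_5" using A by (auto simp: PSL_2_5_def PSL_def carrier_FactGroup)
  have one: "?X = \<one>\<^bsub>PSL_2_5\<^esub> \<longleftrightarrow> A \<in> centre SL25"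
    using SL25.coset_join1[OF _ A centre_SL25.subgroup_axioms] SL25.coset_join2[OF A centre_SL25.subgroup_axioms]
    by (auto simp: PSL_2_5_def PSL_def)
  have "?X [^]\<^bsub>PSL_2_5\<^esub> ?p = centre SL25 #>\<^bsub>SL25\<^esub> (A [^]\<^bsub>SL25\<^esub> ?p)"
    unfolding PSL_2_5_def PSL_def by (rule centre_SL25.FactGroup_pow[OF A])
  also have "\<dots> = \<one>\<^bsub>PSL_2_5\<^esub>"
    using SL25.coset_join2[OF _ centre_SL25.subgroup_axioms SL25_pow_trace_order[OF A]] A
    by (simp add: PSL_2_5_def PSL_def)
  finally have "PSL25.ord ?X dvd ?p" using X by (simp add: PSL25.pow_eq_id)
  then have "PSL25.ord ?X = 1 \<or> PSL25.ord ?X = ?p" using prime_trace_order by (auto simp: prime_nat_iff)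
  moreover have "?p \<noteq> 1" using prime_trace_order by (metis not_prime_1)
  ultimately show ?thesis using PSL25.ord_eq_1[OF X] one by auto
qed

text \<open>The fibres of the projection are the cosets themselves, all of the size of
  \<open>H\<close>. This carries counts of matrices over to the quotient.\<close>

lemma (in normal) card_FactGroup_preimage:
  assumes "finite (carrier G)"
  shows "card {x \<in> carrier G. P (H #> x)} = card H * card {X \<in> carrier (G Mod H). P X}"
proof -
  let ?S = "{x \<in> carrier G. P (H #> x)}" and ?T = "{X \<in> carrier (G Mod H). P X}"
  have T: "finite ?T" using assms by (simp add: carrier_FactGroup)
  have "card ?S = (\<Sum>X\<in>?T. card {x \<in> ?S. H #> x = X})"
  proof -
    have "(\<lambda>x. H #> x) ` ?S \<subseteq> ?T" by (auto simp: carrier_FactGroup)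
    then show ?thesis using sum.group[OF _ T, of ?S "\<lambda>x. H #> x" "\<lambda>_. 1::nat"] assms by simp
  qed
  also have "\<dots> = (\<Sum>X\<in>?T. card H)"
  proof (rule sum.cong[OF refl])
    fix X assume X: "X \<in> ?T"
    then have XR: "X \<in> rcosets H" by (simp add: FactGroup_def)
    then obtain a where a: "a \<in> carrier G" "X = H #> a" by (auto simp: RCOSETS_def)
    have "{x \<in> ?S. H #> x = X} = X"
    proof (intro subset_antisym subsetI)
      fix x assume "x \<in> {x \<in> ?S. H #> x = X}"
      then show "x \<in> X" using rcos_self[OF _ subgroup_axioms, of x] by auto
    next
      fix x assume x: "x \<in> X"
      have "x \<in> carrier G" using elemrcos_carrier[OF is_group a(1)] x a(2) by simp
      moreover have "H #> x = X" using repr_independence[OF _ a(1) subgroup_axioms, of x] x a(2) by simp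
      ultimately show "x \<in> {x \<in> ?S. H #> x = X}" using X by simp
    qed
    then show "card {x \<in> ?S. H #> x = X} = card H"
      using card_rcosets_equal[OF XR subset] by simp
  qed
  finally show ?thesis by simp
qed

lemma card_centre_SL25: "card (centre SL25) = 2"
proof -
  have "mat2 1 0 0 1 \<noteq> (mat2 (-1) 0 0 (-1) :: 5 ^ 2 ^ 2)"
    by (simp add: vec_eq_iff forall_2)
  then show ?thesis by (simp add: centre_SL25)
qed

lemma card_PSL25:
  "2 * card {X \<in> carrier PSL_2_5. P (PSL25.ord X)}
    = card {A \<in> carrier SL25. P (if A \<in> centre SL25 then 1 else trace_order (A$1$1 + A$2$2))}"
proof -
  have "{A \<in> carrier SL25. P (if A \<in> centre SL25 then 1 else trace_order (A$1$1 + A$2$2))}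
      = {A \<in> carrier SL25. P (PSL25.ord (centre SL25 #>\<^bsub>SL25\<^esub> A))}"
    using ord_PSL25 by (intro Collect_cong conj_cong refl) simp
  then show ?thesis
    using centre_SL25.card_FactGroup_preimage[OF finite_SL25, of "\<lambda>X. P (PSL25.ord X)"]
    by (simp add: card_centre_SL25 PSL_2_5_def PSL_def)
qed

lemma trace_centre_SL25: "A \<in> centre SL25 \<Longrightarrow> A$1$1 + A$2$2 = 2 \<or> A$1$1 + A$2$2 = 3"
  by (auto simp: centre_SL25)

lemma finite_PSL25: "finite (carrier PSL_2_5)"
  using finite_SL25 by (simp add: PSL_2_5_def PSL_def carrier_FactGroup)

lemma PSL25_ord_cases:
  assumes "X \<in> carrier PSL_2_5"
  shows "PSL25.ord X \<in> {1, 2, 3, 5}"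
proof -
  obtain A where A: "A \<in> carrier SL25" "X = centre SL25 #>\<^bsub>SL25\<^esub> A"
    using assms by (auto simp: PSL_2_5_def PSL_def carrier_FactGroup)
  show ?thesis unfolding A(2) ord_PSL25[OF A(1)] trace_order_def by simp
qed

text \<open>Half the number of matrices in each case: 30 of trace 0; 20 + 20 of trace 1 or 4; 25 +
  25 of trace 2 or 3, less the two central ones.\<close>

lemma card_PSL25_prime_dvd_ord:
  "card {X \<in> carrier PSL_2_5. 2 dvd PSL25.ord X} = 15"
  "card {X \<in> carrier PSL_2_5. 3 dvd PSL25.ord X} = 20"
  "card {X \<in> carrier PSL_2_5. 5 dvd PSL25.ord X} = 24"
proof -
  let ?tr = "\<lambda>A :: 5 ^ 2 ^ 2. A$1$1 + A$2$2"
  let ?T = "\<lambda>t. {A \<in> carrier SL25. ?tr A = t}"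
  let ?o = "\<lambda>A. if A \<in> centre SL25 then 1 else trace_order (?tr A)"
  have fin: "finite (?T t)" for t using finite_SL25 by simp
  have nc: "A \<notin> centre SL25" if "?tr A \<in> {0, 1, 4}" for A
    using trace_centre_SL25[of A] that by auto
  have "{A \<in> carrier SL25. 2 dvd ?o A} = ?T 0"
    using nc by (auto simp: trace_order_def split: if_splits)
  then show "card {X \<in> carrier PSL_2_5. 2 dvd PSL25.ord X} = 15"
    using card_PSL25[of "\<lambda>n. 2 dvd n"] card_SL25_trace_values by simp
  have "{A \<in> carrier SL25. 3 dvd ?o A} = ?T 1 \<union> ?T 4"
    using nc by (auto simp: trace_order_def split: if_splits)
  moreover have "card (?T 1 \<union> ?T 4) = card (?T 1) + card (?T 4)"
    using fin by (intro card_Un_disjoint) auto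
  ultimately show "card {X \<in> carrier PSL_2_5. 3 dvd PSL25.ord X} = 20"
    using card_PSL25[of "\<lambda>n. 3 dvd n"] card_SL25_trace_values by simp
  have "{A \<in> carrier SL25. 5 dvd ?o A} = (?T 2 \<union> ?T 3) - centre SL25"
    using five_cases by (auto simp: trace_order_def split: if_splits)
  moreover have "card (?T 2 \<union> ?T 3) = card (?T 2) + card (?T 3)"
    using fin by (intro card_Un_disjoint) auto
  moreover have "card ((?T 2 \<union> ?T 3) - centre SL25) = card (?T 2 \<union> ?T 3) - card (centre SL25)"
    using trace_centre_SL25 centre_SL25.subset finite_subset[OF centre_SL25.subset finite_SL25]
    by (intro card_Diff_subset) auto
  ultimately show "card {X \<in> carrier PSL_2_5. 5 dvd PSL25.ord X} = 24"
    using card_PSL25[of "\<lambda>n. 5 dvd n"] card_SL25_trace_values card_centre_SL25 by simp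
qed

lemma order_PSL25: "order PSL_2_5 = 60"
proof -
  let ?T = "\<lambda>t. {A \<in> carrier SL25. A$1$1 + A$2$2 = t}"
  have "carrier SL25 = (\<Union>t\<in>UNIV. ?T t)" by blast
  then have "card (carrier SL25) = card (\<Union>t\<in>UNIV. ?T t)" by simp
  also have "\<dots> = (\<Sum>t\<in>UNIV. card (?T t))"
    using finite_SL25 by (intro card_UN_disjoint) auto
  also have "\<dots> = 120" by (simp add: sum_UNIV_5 card_SL25_trace_values)
  finally show ?thesis using card_PSL25[of "\<lambda>_. True"] by (simp add: order_def)
qed

lemma Exp_rho_PSL25: "Exp_rho PSL_2_5 = {15, 20, 24}"
proof -
  have le: "multiplicity p (PSL25.ord X) \<le> 1" if "X \<in> carrier PSL_2_5" "prime p" for p X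
  proof -
    have "PSL25.ord X = 1 \<or> prime (PSL25.ord X)" using PSL25_ord_cases[OF that(1)] by auto
    moreover have "multiplicity p n \<le> 1" if "prime n" for n :: nat
    proof (cases "p = n")
      case True
      then show ?thesis using multiplicity_same_power'[of n 1] that by simp
    next
      case False
      then have "\<not> p dvd n" using primes_dvd_imp_eq \<open>prime p\<close> that by blast
      then show ?thesis by (simp add: not_dvd_imp_multiplicity_0)
    qed
    ultimately show ?thesis by auto
  qed
  have m: "multiplicity p (rho PSL_2_5) = card {X \<in> carrier PSL_2_5. p dvd PSL25.ord X}" if "prime p" for p
    by (rule PSL25.multiplicity_rho_eq_card[OF finite_PSL25 that le[OF _ that]])
  have m': "multiplicity 2 (rho PSL_2_5) = 15" "multiplicity 3 (rho PSL_2_5) = 20"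
    "multiplicity 5 (rho PSL_2_5) = 24"
    using m[of 2] m[of 3] m[of 5] card_PSL25_prime_dvd_ord by simp_all
  have "Exp_rho PSL_2_5 = (\<lambda>p. multiplicity p (rho PSL_2_5)) ` {2, 3, 5}"
  proof (rule Exp_rho_eq_image[OF group_PSL_2_5 finite_PSL25])
    fix p :: nat assume p: "prime p" "p dvd order PSL_2_5"
    have "(60::nat) = 2 * 2 * 3 * 5" by simp
    then have "p dvd 2 * 2 * 3 * 5" using p(2) order_PSL25 by metis
    then have "p dvd 2 \<or> p dvd 3 \<or> p dvd 5" using p(1) by (auto simp only: prime_dvd_mult_iff)
    moreover have "prime (2::nat)" "prime (3::nat)" "prime (5::nat)" by simp_all
    ultimately show "p \<in> {2, 3, 5}" using p(1) primes_dvd_imp_eq by blast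
  next
    fix p :: nat assume "p \<in> {2, 3, 5}"
    then show "prime p \<and> multiplicity p (rho PSL_2_5) > 0" using m' by auto
  qed
  then show ?thesis using m' by auto
qed

section \<open>The classification and the equivalence\<close>

lemma (in group) Exp_rho_classification:
  fixes q r :: nat
  assumes "finite (carrier G)" "prime q" "odd q" "prime r" "odd r" "q \<noteq> r"
    and "Exp_rho G = {q * r, 2 * r * (q - 1), 2 * q * (r - 1)}"
  shows "G \<cong> integer_mod_group (2 * q * r) \<or> ({q, r} = {3, 5} \<and> G \<cong> alt_group 5)"
proof -
  obtain a where a: "two_prime_exponent_group G q r a"
    using two_prime_exponent_groupI[OF assms] by blast
  then interpret two_prime_exponent_group G q r a .
  show ?thesis
  proof (cases "a = 1")
    case True
    then show ?thesis using cyclic_if_a_eq_1 by blast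
  next
    case False
    then have a2: "a = 2" using a_cases by simp
    have S: "order_4qr_exponent_group G q r" "order_4qr_exponent_group G r q"
      using a swap unfolding a2 order_4qr_exponent_group_def by simp_all
    consider "q = 3" | "r = 3" using order_4qr_exponent_group.three_cases[OF S(1)] by blast
    then have "{q, r} = {3, 5} \<and> order_60_group G"
    proof cases
      case 1
      then have "r = 5" using order_4qr_exponent_group.r_eq_5[OF S(1)] by simp
      then show ?thesis using 1 S(1) by (simp add: order_60_group_def)
    next
      case 2
      then have "q = 5" using order_4qr_exponent_group.r_eq_5[OF S(2)] by simp
      then show ?thesis using 2 S(2) by (simp add: order_60_group_def insert_commute)
    qed
    then show ?thesis using order_60_group.iso_alt_group by blast
  qed
qed

text \<open>Because the classification ends in \<open>alt_group 5\<close> and not in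
  \<open>PSL_2_5\<close>, it can be applied to \<open>PSL_2_5\<close> itself, with
  \<open>q = 3\<close> and \<open>r = 5\<close>; order 60 against 30 excludes the cyclic
  case.\<close>

lemma PSL25_iso_alt_group: "PSL_2_5 \<cong> alt_group 5"
proof -
  have "Exp_rho PSL_2_5 = {3 * 5, 2 * 5 * (3 - 1), 2 * 3 * (5 - 1)}" by (simp add: Exp_rho_PSL25)
  then have "PSL_2_5 \<cong> integer_mod_group (2 * 3 * 5) \<or> PSL_2_5 \<cong> alt_group 5"
    using PSL25.Exp_rho_classification[OF finite_PSL25, of 3 5] by simp
  moreover have "\<not> PSL_2_5 \<cong> integer_mod_group (2 * 3 * 5)"
  proof
    assume "PSL_2_5 \<cong> integer_mod_group (2 * 3 * 5)"
    then have "order PSL_2_5 = card (carrier (integer_mod_group (2 * 3 * 5)))"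
      unfolding order_def by (rule iso_same_card)
    then show False by (simp add: order_PSL25 carrier_integer_mod_group)
  qed
  ultimately show ?thesis by blast
qed

text \<open>The only odd exponent of PSL(2,5) is 15, and the only odd one of the cyclic group is
  \<open>q * r\<close>; the sets can agree only for the primes 3 and 5, so the first alternative has
  to carry this condition.\<close>

theorem theorem2p14:
  fixes G :: "('a, 'b) monoid_scheme" and q r :: nat
  assumes "group G" and "finite (carrier G)"
    and "prime q" and "odd q" and "prime r" and "odd r" and "q \<noteq> r"
  shows "(G \<cong> PSL_2_5 \<and> {q, r} = {3, 5}) \<or> G \<cong> integer_mod_group (2 * q * r)
    \<longleftrightarrow> Exp_rho G = Exp_rho (integer_mod_group (2 * q * r))"
proof -
  interpret group G by fact
  note Z = Exp_rho_integer_mod_group[OF assms(3-7)]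
  show ?thesis
  proof
    assume "(G \<cong> PSL_2_5 \<and> {q, r} = {3, 5}) \<or> G \<cong> integer_mod_group (2 * q * r)"
    then show "Exp_rho G = Exp_rho (integer_mod_group (2 * q * r))"
    proof
      assume *: "G \<cong> PSL_2_5 \<and> {q, r} = {3, 5}"
      have "rho G = rho PSL_2_5" using rho_iso[OF assms(1) group_PSL_2_5] * by blast
      then have exp: "Exp_rho G = {15, 20, 24}"
        using Exp_rho_PSL25 unfolding Exp_rho_def by argo
      have "q = 3 \<and> r = 5 \<or> q = 5 \<and> r = 3" using * unfolding doubleton_eq_iff by blast
      then show ?thesis
      proof
        assume "q = 3 \<and> r = 5"
        then show ?thesis unfolding Z exp by simp
      next
        assume "q = 5 \<and> r = 3"
        then show ?thesis unfolding Z exp by (simp add: insert_commute)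
      qed
    next
      assume "G \<cong> integer_mod_group (2 * q * r)"
      then have "rho G = rho (integer_mod_group (2 * q * r))"
        by (rule rho_iso[OF assms(1) group_integer_mod_group])
      then show ?thesis unfolding Exp_rho_def by (rule arg_cong)
    qed
  next
    assume "Exp_rho G = Exp_rho (integer_mod_group (2 * q * r))"
    then have "G \<cong> integer_mod_group (2 * q * r) \<or> ({q, r} = {3, 5} \<and> G \<cong> alt_group 5)"
      using Exp_rho_classification[OF assms(2-7)] Z by simp
    moreover have "G \<cong> PSL_2_5" if "G \<cong> alt_group 5"
      using iso_trans[OF that group.iso_sym[OF group_PSL_2_5 PSL25_iso_alt_group]] .
    ultimately show "(G \<cong> PSL_2_5 \<and> {q, r} = {3, 5}) \<or> G \<cong> integer_mod_group (2 * q * r)"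
      by blast
  qed
qed

end
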